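(* Let $\Bbbk$ be a field of characteristic not $2$ in which $3\neq-2$, and assume $\Bbbk$ contains a square root $\sqrt{-1}$ of $-1$. There is a unique $\Bbbk$-linear monoidal functor $\Phi\colon\mathcal{SL}\to\mathrm{Kar}(\mathcal{TL}(-2))$ given on objects by sending the generating object $X$ to $(Y\otimes Y,e)$, and on morphisms by $$\varepsilon\mapsto \varepsilon_Y\circ(1\otimes\varepsilon_Y\otimes1)\circ(e\otimes e),$$ $$m\mapsto\sqrt{-1}\; e\circ(1\otimes\varepsilon_Y\otimes1)\circ(e\otimes e),$$ $$s\mapsto (1\otimes s_Y\otimes1)\circ(s_Y\otimes s_Y)\circ(1\otimes s_Y\otimes1)\circ(e\otimes e),$$ where on the right-hand sides $1=\mathrm{id}_Y$.
   Context: All categories are $\Bbbk$-linear, and composition is written right to left. The category $\mathcal{SL}$. For $\delta\in\Bbbk$, $\alpha\in\Bbbk^\times$, $\mathcal T_{\delta,\alpha}$ is the strict $\Bbbk$-linear monoidal category (unit object $\mathbf 1$) generated by one object $X$ and morphisms $$m\colon X\otimes X\to X,\quad s\colon X\otimes X\to X\otimes X,\quad \eta\colon\mathbf 1\to X\otimes X,\quad \varepsilon\colon X\otimes X\to\mathbf 1,$$ subject to the following relations (writing $1$ for $\mathrm{id}_X$): (i) $(\varepsilon\otimes1)(1\otimes\eta)=1=(1\otimes\varepsilon)(\eta\otimes1)$; (ii) $\sigma:=(1\otimes m)(\eta\otimes 1)=(m\otimes1)(1\otimes\eta)\colon X\to X\otimes X$; (iii) $(1\otimes\varepsilon)(s\otimes1)=(\varepsilon\otimes1)(1\otimes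 s)$; (iv) $s\circ s=1\otimes1$ and $(s\otimes1)(1\otimes s)(s\otimes1)=(1\otimes s)(s\otimes1)(1\otimes s)$; (v) $(1\otimes m)(s\otimes1)(1\otimes s)=s(m\otimes1)$ and $(1\otimes s)(s\otimes1)(1\otimes\sigma)=(\sigma\otimes1)s$; (vi) $\varepsilon s=\varepsilon$, $\; m s=-m$, $\; m\sigma=\alpha\,1$, $\;\varepsilon\eta=\delta\,\mathrm{id}_{\mathbf 1}$. Put $K:=\sigma m$, $H:=(m\otimes1)(1\otimes\sigma)=(1\otimes m)(\sigma\otimes1)$, $D:=(m\otimes1)(1\otimes s)(\sigma\otimes1)$. Then $\mathcal{SL}$ is the quotient of $\mathcal T_{3,1}$ by the tensor ideal generated by the relations $D=K-H$ and $K=\frac12(1_{X\otimes X}-s)$. The category $\mathcal{TL}(-2)$ is the Temperley–Lieb category: the strict $\Bbbk$-linear monoidal category generated by one object $Y$ and morphisms $\eta_Y\colon\mathbf 1\to Y\otimes Y$, $\varepsilon_Y\colon Y\otimes Y\to\mathbf 1$ subject to $(\varepsilon_Y\otimes1)(1\otimes\eta_Y)=1=(1\otimes\varepsilon_Y)(\eta_Y\otimes1)$ and $\varepsilon_Y\eta_Y=-2\,\mathrm{id}_{\mathbf 1}$. It is symmetric with braiding determined by $s_Y:=1_{Y\otimes Y}+\eta_Y\varepsilon_Y$. Define the idempotent $$e:=\tfrac12(1_{Y\otimes Y}+s_Y)=1_{Y\otimes Y}+\tfrac12\eta_Y\varepsilon_Y\in\mathcal{TL}(-2)(Y\otimes Y,Y\otimes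 Y).$$ $\mathrm{Kar}(\mathcal C)$ is the additive Karoubi envelope of $\mathcal C$: objects are pairs $(Z,f)$ with $Z$ an object of the additive envelope $\mathrm{Add}(\mathcal C)$ and $f$ an idempotent endomorphism of $Z$; $\mathrm{Kar}(\mathcal C)((Z,f),(Z',f'))=f'\,\mathrm{Add}(\mathcal C)(Z,Z')\,f$; composition is as in $\mathcal C$, and $(Z,f)\otimes(Z',f')=(Z\otimes Z',f\otimes f')$. *)

theory Defs
  imports "HOL-Library.FuncSet"
begin

section \<open>Strict linear monoidal categories\<close>

text \<open>
  A morphism carries its source and its target, so that different hom-sets are always disjoint
  and the operations below need no object arguments.  All operations are meaningful only on
  (composable, respectively parallel) elements of \<open>arrs\<close>.
\<close>

datatype ('o, 'b) arrow = Arrow (src: 'o) (tgt: 'o) (body: 'b)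

record ('o, 'b, 'k) lmcat =
  objs :: "'o set"
  arrs :: "('o, 'b) arrow set"
  ident :: "'o \<Rightarrow> ('o, 'b) arrow"  (\<open>\<one>\<index>\<close>)
  compose :: "('o, 'b) arrow \<Rightarrow> ('o, 'b) arrow \<Rightarrow> ('o, 'b) arrow"  (infixr \<open>\<cdot>\<index>\<close> 70)
  plus_arr :: "('o, 'b) arrow \<Rightarrow> ('o, 'b) arrow \<Rightarrow> ('o, 'b) arrow"  (infixl \<open>\<oplus>\<index>\<close> 65)
  zero_arr :: "'o \<Rightarrow> 'o \<Rightarrow> ('o, 'b) arrow"
  scale_arr :: "'k \<Rightarrow> ('o, 'b) arrow \<Rightarrow> ('o, 'b) arrow"  (infixr \<open>\<odot>\<index>\<close> 68)
  unit_obj :: "'o"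
  tensor_obj :: "'o \<Rightarrow> 'o \<Rightarrow> 'o"  (infixr \<open>\<boxtimes>\<index>\<close> 75)
  tensor_arr :: "('o, 'b) arrow \<Rightarrow> ('o, 'b) arrow \<Rightarrow> ('o, 'b) arrow"  (infixr \<open>\<otimes>\<index>\<close> 75)

definition hom :: "('o, 'b, 'k) lmcat \<Rightarrow> 'o \<Rightarrow> 'o \<Rightarrow> ('o, 'b) arrow set" where
  "hom C a b = {f \<in> arrs C. src f = a \<and> tgt f = b}"

datatype ('o, 'b, 'p, 'c) functor_data =
  Functor (obj_map: "'o \<Rightarrow> 'p") (arr_map: "('o, 'b) arrow \<Rightarrow> ('p, 'c) arrow")

text \<open>
  All monoidal categories here are strict, and so are monoidal functors.  The two maps are
  required to be undefined outside the source category, so that equality of functor data is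
  equality of functors.
\<close>

locale linear_monoidal_functor =
  fixes C :: "('o, 'b, 'k::field) lmcat"  (structure)
    and D :: "('p, 'c, 'k) lmcat"  (structure)
    and \<Phi> :: "('o, 'b, 'p, 'c) functor_data"
  assumes obj_map: "obj_map \<Phi> \<in> objs C \<rightarrow>\<^sub>E objs D"
    and arr_map_undefined: "arr_map \<Phi> \<in> extensional (arrs C)"
    and arr_map: "f \<in> arrs C \<Longrightarrow>
          arr_map \<Phi> f \<in> hom D (obj_map \<Phi> (src f)) (obj_map \<Phi> (tgt f))"
    and map_ident: "a \<in> objs C \<Longrightarrow> arr_map \<Phi> (\<one> a) = \<one>\<^bsub>D\<^esub> (obj_map \<Phi> a)"
    and map_compose: "\<lbrakk>f \<in> arrs C; g \<in> arrs C; src g = tgt f\<rbrakk> \<Longrightarrow>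
          arr_map \<Phi> (g \<cdot> f) = arr_map \<Phi> g \<cdot>\<^bsub>D\<^esub> arr_map \<Phi> f"
    and map_plus: "\<lbrakk>f \<in> arrs C; g \<in> arrs C; src f = src g; tgt f = tgt g\<rbrakk> \<Longrightarrow>
          arr_map \<Phi> (f \<oplus> g) = arr_map \<Phi> f \<oplus>\<^bsub>D\<^esub> arr_map \<Phi> g"
    and map_scale: "f \<in> arrs C \<Longrightarrow> arr_map \<Phi> (c \<odot> f) = c \<odot>\<^bsub>D\<^esub> arr_map \<Phi> f"
    and map_unit_obj: "obj_map \<Phi> (unit_obj C) = unit_obj D"
    and map_tensor_obj: "\<lbrakk>a \<in> objs C; b \<in> objs C\<rbrakk> \<Longrightarrow>
          obj_map \<Phi> (a \<boxtimes> b) = obj_map \<Phi> a \<boxtimes>\<^bsub>D\<^esub> obj_map \<Phi> b"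
    and map_tensor_arr: "\<lbrakk>f \<in> arrs C; g \<in> arrs C\<rbrakk> \<Longrightarrow>
          arr_map \<Phi> (f \<otimes> g) = arr_map \<Phi> f \<otimes>\<^bsub>D\<^esub> arr_map \<Phi> g"


section \<open>Presentations with one generating object\<close>

text \<open>
  The objects of a strict monoidal category generated by one object \<open>X\<close> are the tensor powers
  of \<open>X\<close>; the natural number \<open>n\<close> stands for the \<open>n\<close>-th one, so \<open>0\<close> is the unit object and
  \<open>1\<close> is \<open>X\<close>.
\<close>

datatype ('g, 'k) trm =
    Gen 'g
  | Idt nat
  | Zer nat nat
  | Cmp "('g, 'k) trm" "('g, 'k) trm"  (infixr \<open>\<circ>\<^sub>t\<close> 70)
  | Tns "('g, 'k) trm" "('g, 'k) trm"  (infixr \<open>\<otimes>\<^sub>t\<close> 75)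
  | Pls "('g, 'k) trm" "('g, 'k) trm"  (infixl \<open>+\<^sub>t\<close> 65)
  | Scl 'k "('g, 'k) trm"  (infixr \<open>*\<^sub>t\<close> 68)

text \<open>In the following, \<open>ar g = (m, n)\<close> says that the generator \<open>g\<close> is a morphism from the
  \<open>m\<close>-th to the \<open>n\<close>-th tensor power.\<close>

primrec tdom :: "('g \<Rightarrow> nat \<times> nat) \<Rightarrow> ('g, 'k) trm \<Rightarrow> nat" where
  "tdom ar (Gen g) = fst (ar g)"
| "tdom ar (Idt n) = n"
| "tdom ar (Zer m n) = m"
| "tdom ar (t \<circ>\<^sub>t u) = tdom ar u"
| "tdom ar (t \<otimes>\<^sub>t u) = tdom ar t + tdom ar u"
| "tdom ar (t +\<^sub>t u) = tdom ar t"
| "tdom ar (c *\<^sub>t t) = tdom ar t"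

primrec tcod :: "('g \<Rightarrow> nat \<times> nat) \<Rightarrow> ('g, 'k) trm \<Rightarrow> nat" where
  "tcod ar (Gen g) = snd (ar g)"
| "tcod ar (Idt n) = n"
| "tcod ar (Zer m n) = n"
| "tcod ar (t \<circ>\<^sub>t u) = tcod ar t"
| "tcod ar (t \<otimes>\<^sub>t u) = tcod ar t + tcod ar u"
| "tcod ar (t +\<^sub>t u) = tcod ar t"
| "tcod ar (c *\<^sub>t t) = tcod ar t"

primrec wft :: "('g \<Rightarrow> nat \<times> nat) \<Rightarrow> ('g, 'k) trm \<Rightarrow> bool" where
  "wft ar (Gen g) \<longleftrightarrow> True"
| "wft ar (Idt n) \<longleftrightarrow> True"
| "wft ar (Zer m n) \<longleftrightarrow> True"
| "wft ar (t \<circ>\<^sub>t u) \<longleftrightarrow> wft ar t \<and> wft ar u \<and> tdom ar t = tcod ar u"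
| "wft ar (t \<otimes>\<^sub>t u) \<longleftrightarrow> wft ar t \<and> wft ar u"
| "wft ar (t +\<^sub>t u) \<longleftrightarrow> wft ar t \<and> wft ar u \<and> tdom ar t = tdom ar u \<and> tcod ar t = tcod ar u"
| "wft ar (c *\<^sub>t t) \<longleftrightarrow> wft ar t"

text \<open>The least congruence on well-formed terms that contains the axioms of strict linear
  monoidal categories and the relations \<open>R\<close>.\<close>

inductive teq :: "('g \<Rightarrow> nat \<times> nat) \<Rightarrow> (('g, 'k::field) trm \<times> ('g, 'k) trm) set
    \<Rightarrow> ('g, 'k) trm \<Rightarrow> ('g, 'k) trm \<Rightarrow> bool"
  for ar R where
  rel: "\<lbrakk>(t, u) \<in> R; wft ar t; wft ar u; tdom ar t = tdom ar u; tcod ar t = tcod ar u\<rbrakk> \<Longrightarrow> teq ar R t u"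
| refl: "wft ar t \<Longrightarrow> teq ar R t t"
| sym: "teq ar R t u \<Longrightarrow> teq ar R u t"
| trans: "\<lbrakk>teq ar R t u; teq ar R u v\<rbrakk> \<Longrightarrow> teq ar R t v"
| cmp_cong: "\<lbrakk>teq ar R t t'; teq ar R u u'; tdom ar t = tcod ar u\<rbrakk> \<Longrightarrow> teq ar R (t \<circ>\<^sub>t u) (t' \<circ>\<^sub>t u')"
| tns_cong: "\<lbrakk>teq ar R t t'; teq ar R u u'\<rbrakk> \<Longrightarrow> teq ar R (t \<otimes>\<^sub>t u) (t' \<otimes>\<^sub>t u')"
| pls_cong: "\<lbrakk>teq ar R t t'; teq ar R u u'; tdom ar t = tdom ar u; tcod ar t = tcod ar u\<rbrakk>
    \<Longrightarrow> teq ar R (t +\<^sub>t u) (t' +\<^sub>t u')"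
| scl_cong: "teq ar R t t' \<Longrightarrow> teq ar R (c *\<^sub>t t) (c *\<^sub>t t')"
| cmp_id_left: "wft ar t \<Longrightarrow> teq ar R (Idt (tcod ar t) \<circ>\<^sub>t t) t"
| cmp_id_right: "wft ar t \<Longrightarrow> teq ar R (t \<circ>\<^sub>t Idt (tdom ar t)) t"
| cmp_assoc: "wft ar (t \<circ>\<^sub>t u \<circ>\<^sub>t v) \<Longrightarrow> teq ar R ((t \<circ>\<^sub>t u) \<circ>\<^sub>t v) (t \<circ>\<^sub>t u \<circ>\<^sub>t v)"
| tns_unit_left: "wft ar t \<Longrightarrow> teq ar R (Idt 0 \<otimes>\<^sub>t t) t"
| tns_unit_right: "wft ar t \<Longrightarrow> teq ar R (t \<otimes>\<^sub>t Idt 0) t"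
| tns_assoc: "wft ar (t \<otimes>\<^sub>t u \<otimes>\<^sub>t v) \<Longrightarrow> teq ar R ((t \<otimes>\<^sub>t u) \<otimes>\<^sub>t v) (t \<otimes>\<^sub>t u \<otimes>\<^sub>t v)"
| tns_id: "teq ar R (Idt m \<otimes>\<^sub>t Idt n) (Idt (m + n))"
| interchange: "\<lbrakk>wft ar (t \<circ>\<^sub>t u); wft ar (t' \<circ>\<^sub>t u')\<rbrakk>
    \<Longrightarrow> teq ar R ((t \<otimes>\<^sub>t t') \<circ>\<^sub>t (u \<otimes>\<^sub>t u')) ((t \<circ>\<^sub>t u) \<otimes>\<^sub>t (t' \<circ>\<^sub>t u'))"
| pls_assoc: "wft ar (t +\<^sub>t (u +\<^sub>t v)) \<Longrightarrow> teq ar R ((t +\<^sub>t u) +\<^sub>t v) (t +\<^sub>t (u +\<^sub>t v))"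
| pls_commute: "wft ar (t +\<^sub>t u) \<Longrightarrow> teq ar R (t +\<^sub>t u) (u +\<^sub>t t)"
| pls_zero: "wft ar t \<Longrightarrow> teq ar R (t +\<^sub>t Zer (tdom ar t) (tcod ar t)) t"
| pls_neg: "wft ar t \<Longrightarrow> teq ar R (t +\<^sub>t (- 1) *\<^sub>t t) (Zer (tdom ar t) (tcod ar t))"
| scl_pls: "wft ar (t +\<^sub>t u) \<Longrightarrow> teq ar R (c *\<^sub>t (t +\<^sub>t u)) (c *\<^sub>t t +\<^sub>t c *\<^sub>t u)"
| pls_scl: "wft ar t \<Longrightarrow> teq ar R ((c + d) *\<^sub>t t) (c *\<^sub>t t +\<^sub>t d *\<^sub>t t)"
| scl_scl: "wft ar t \<Longrightarrow> teq ar R ((c * d) *\<^sub>t t) (c *\<^sub>t d *\<^sub>t t)"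
| scl_one: "wft ar t \<Longrightarrow> teq ar R (1 *\<^sub>t t) t"
| cmp_pls_left: "wft ar ((t +\<^sub>t u) \<circ>\<^sub>t v) \<Longrightarrow> teq ar R ((t +\<^sub>t u) \<circ>\<^sub>t v) (t \<circ>\<^sub>t v +\<^sub>t u \<circ>\<^sub>t v)"
| cmp_pls_right: "wft ar (t \<circ>\<^sub>t (u +\<^sub>t v)) \<Longrightarrow> teq ar R (t \<circ>\<^sub>t (u +\<^sub>t v)) (t \<circ>\<^sub>t u +\<^sub>t t \<circ>\<^sub>t v)"
| cmp_scl_left: "wft ar (t \<circ>\<^sub>t u) \<Longrightarrow> teq ar R ((c *\<^sub>t t) \<circ>\<^sub>t u) (c *\<^sub>t (t \<circ>\<^sub>t u))"
| cmp_scl_right: "wft ar (t \<circ>\<^sub>t u) \<Longrightarrow> teq ar R (t \<circ>\<^sub>t (c *\<^sub>t u)) (c *\<^sub>t (t \<circ>\<^sub>t u))"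
| tns_pls_left: "wft ar ((t +\<^sub>t u) \<otimes>\<^sub>t v) \<Longrightarrow> teq ar R ((t +\<^sub>t u) \<otimes>\<^sub>t v) (t \<otimes>\<^sub>t v +\<^sub>t u \<otimes>\<^sub>t v)"
| tns_pls_right: "wft ar (t \<otimes>\<^sub>t (u +\<^sub>t v)) \<Longrightarrow> teq ar R (t \<otimes>\<^sub>t (u +\<^sub>t v)) (t \<otimes>\<^sub>t u +\<^sub>t t \<otimes>\<^sub>t v)"
| tns_scl_left: "wft ar (t \<otimes>\<^sub>t u) \<Longrightarrow> teq ar R ((c *\<^sub>t t) \<otimes>\<^sub>t u) (c *\<^sub>t (t \<otimes>\<^sub>t u))"
| tns_scl_right: "wft ar (t \<otimes>\<^sub>t u) \<Longrightarrow> teq ar R (t \<otimes>\<^sub>t (c *\<^sub>t u)) (c *\<^sub>t (t \<otimes>\<^sub>t u))"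

definition tclass :: "('g \<Rightarrow> nat \<times> nat) \<Rightarrow> (('g, 'k::field) trm \<times> ('g, 'k) trm) set
    \<Rightarrow> ('g, 'k) trm \<Rightarrow> (nat, ('g, 'k) trm set) arrow" where
  "tclass ar R t = Arrow (tdom ar t) (tcod ar t) {u. teq ar R t u}"

definition rep :: "('o, 'b set) arrow \<Rightarrow> 'b" where
  "rep F = (SOME f. f \<in> body F)"

definition presented :: "('g \<Rightarrow> nat \<times> nat) \<Rightarrow> (('g, 'k::field) trm \<times> ('g, 'k) trm) set
    \<Rightarrow> (nat, ('g, 'k) trm set, 'k) lmcat" where
  "presented ar R =
    \<lparr> objs = UNIV,
      arrs = tclass ar R ` {t. wft ar t},
      ident = (\<lambda>n. tclass ar R (Idt n)),
      compose = (\<lambda>F G. tclass ar R (rep F \<circ>\<^sub>t rep G)),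
      plus_arr = (\<lambda>F G. tclass ar R (rep F +\<^sub>t rep G)),
      zero_arr = (\<lambda>m n. tclass ar R (Zer m n)),
      scale_arr = (\<lambda>c F. tclass ar R (c *\<^sub>t rep F)),
      unit_obj = 0,
      tensor_obj = (+),
      tensor_arr = (\<lambda>F G. tclass ar R (rep F \<otimes>\<^sub>t rep G)) \<rparr>"


section \<open>Quotients by tensor ideals\<close>

inductive_set tensor_ideal :: "('o, 'b, 'k) lmcat \<Rightarrow> ('o, 'b) arrow set \<Rightarrow> ('o, 'b) arrow set"
  for C (structure) and S where
  gen: "f \<in> S \<Longrightarrow> f \<in> tensor_ideal C S"
| zero: "\<lbrakk>a \<in> objs C; b \<in> objs C\<rbrakk> \<Longrightarrow> zero_arr C a b \<in> tensor_ideal C S"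
| plus: "\<lbrakk>f \<in> tensor_ideal C S; g \<in> tensor_ideal C S; src f = src g; tgt f = tgt g\<rbrakk>
    \<Longrightarrow> f \<oplus> g \<in> tensor_ideal C S"
| scale: "f \<in> tensor_ideal C S \<Longrightarrow> c \<odot> f \<in> tensor_ideal C S"
| comp_left: "\<lbrakk>f \<in> tensor_ideal C S; g \<in> arrs C; src g = tgt f\<rbrakk> \<Longrightarrow> g \<cdot> f \<in> tensor_ideal C S"
| comp_right: "\<lbrakk>f \<in> tensor_ideal C S; g \<in> arrs C; src f = tgt g\<rbrakk> \<Longrightarrow> f \<cdot> g \<in> tensor_ideal C S"
| tensor_left: "\<lbrakk>f \<in> tensor_ideal C S; g \<in> arrs C\<rbrakk> \<Longrightarrow> g \<otimes> f \<in> tensor_ideal C S"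
| tensor_right: "\<lbrakk>f \<in> tensor_ideal C S; g \<in> arrs C\<rbrakk> \<Longrightarrow> f \<otimes> g \<in> tensor_ideal C S"

definition coset :: "('o, 'b, 'k::field) lmcat \<Rightarrow> ('o, 'b) arrow set
    \<Rightarrow> ('o, 'b) arrow \<Rightarrow> ('o, ('o, 'b) arrow set) arrow" where
  "coset C I f = Arrow (src f) (tgt f)
     {g \<in> hom C (src f) (tgt f). g \<oplus>\<^bsub>C\<^esub> (- 1) \<odot>\<^bsub>C\<^esub> f \<in> I}"

definition quotient_cat :: "('o, 'b, 'k::field) lmcat \<Rightarrow> ('o, 'b) arrow set
    \<Rightarrow> ('o, ('o, 'b) arrow set, 'k) lmcat" where
  "quotient_cat C I =
    \<lparr> objs = objs C,
      arrs = coset C I ` arrs C,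
      ident = (\<lambda>a. coset C I (\<one>\<^bsub>C\<^esub> a)),
      compose = (\<lambda>F G. coset C I (rep F \<cdot>\<^bsub>C\<^esub> rep G)),
      plus_arr = (\<lambda>F G. coset C I (rep F \<oplus>\<^bsub>C\<^esub> rep G)),
      zero_arr = (\<lambda>a b. coset C I (zero_arr C a b)),
      scale_arr = (\<lambda>c F. coset C I (c \<odot>\<^bsub>C\<^esub> rep F)),
      unit_obj = unit_obj C,
      tensor_obj = tensor_obj C,
      tensor_arr = (\<lambda>F G. coset C I (rep F \<otimes>\<^bsub>C\<^esub> rep G)) \<rparr>"


section \<open>The additive Karoubi envelope\<close>

text \<open>
  An object of the additive envelope is a list of objects, read as their formal direct sum.
  The body of a morphism from \<open>as\<close> to \<open>bs\<close> is a matrix with \<open>length bs\<close> rows and \<open>length as\<close>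
  columns, whose entry at \<open>(i, j)\<close> is a morphism from \<open>as ! j\<close> to \<open>bs ! i\<close>.  The summands of a
  tensor product are ordered lexicographically, which makes the tensor product strict; the
  tensor product of two morphisms is the Kronecker product of their matrices.
\<close>

definition sum_arr :: "('o, 'b, 'k) lmcat \<Rightarrow> 'o \<Rightarrow> 'o \<Rightarrow> (nat \<Rightarrow> ('o, 'b) arrow) \<Rightarrow> nat \<Rightarrow> ('o, 'b) arrow"
  where "sum_arr C a b f n = foldr (\<lambda>j g. f j \<oplus>\<^bsub>C\<^esub> g) [0..<n] (zero_arr C a b)"

definition mat_arrow :: "'o list \<Rightarrow> 'o list \<Rightarrow> (nat \<Rightarrow> nat \<Rightarrow> ('o, 'b) arrow)
    \<Rightarrow> ('o list, nat \<times> nat \<Rightarrow> ('o, 'b) arrow) arrow" where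
  "mat_arrow as bs M = Arrow as bs (\<lambda>(i, j) \<in> {..<length bs} \<times> {..<length as}. M i j)"

definition entry :: "('o list, nat \<times> nat \<Rightarrow> ('o, 'b) arrow) arrow \<Rightarrow> nat \<Rightarrow> nat \<Rightarrow> ('o, 'b) arrow"
  where "entry F i j = body F (i, j)"

definition additive_envelope :: "('o, 'b, 'k) lmcat
    \<Rightarrow> ('o list, nat \<times> nat \<Rightarrow> ('o, 'b) arrow, 'k) lmcat" where
  "additive_envelope C =
    \<lparr> objs = lists (objs C),
      arrs = {mat_arrow as bs M | as bs M. as \<in> lists (objs C) \<and> bs \<in> lists (objs C) \<and>
                (\<forall>i < length bs. \<forall>j < length as. M i j \<in> hom C (as ! j) (bs ! i))},
      ident = (\<lambda>as. mat_arrow as as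
                (\<lambda>i j. if i = j then \<one>\<^bsub>C\<^esub> (as ! i) else zero_arr C (as ! j) (as ! i))),
      compose = (\<lambda>F G. mat_arrow (src G) (tgt F)
                (\<lambda>i k. sum_arr C (src G ! k) (tgt F ! i)
                  (\<lambda>j. entry F i j \<cdot>\<^bsub>C\<^esub> entry G j k) (length (tgt G)))),
      plus_arr = (\<lambda>F G. mat_arrow (src F) (tgt F) (\<lambda>i j. entry F i j \<oplus>\<^bsub>C\<^esub> entry G i j)),
      zero_arr = (\<lambda>as bs. mat_arrow as bs (\<lambda>i j. zero_arr C (as ! j) (bs ! i))),
      scale_arr = (\<lambda>c F. mat_arrow (src F) (tgt F) (\<lambda>i j. c \<odot>\<^bsub>C\<^esub> entry F i j)),
      unit_obj = [unit_obj C],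
      tensor_obj = (\<lambda>as bs. [a \<boxtimes>\<^bsub>C\<^esub> b. a \<leftarrow> as, b \<leftarrow> bs]),
      tensor_arr = (\<lambda>F G. mat_arrow
                [a \<boxtimes>\<^bsub>C\<^esub> b. a \<leftarrow> src F, b \<leftarrow> src G]
                [a \<boxtimes>\<^bsub>C\<^esub> b. a \<leftarrow> tgt F, b \<leftarrow> tgt G]
                (\<lambda>i j. entry F (i div length (tgt G)) (j div length (src G))
                   \<otimes>\<^bsub>C\<^esub> entry G (i mod length (tgt G)) (j mod length (src G)))) \<rparr>"

definition add_incl :: "('o, 'b) arrow \<Rightarrow> ('o list, nat \<times> nat \<Rightarrow> ('o, 'b) arrow) arrow" where
  "add_incl f = mat_arrow [src f] [tgt f] (\<lambda>i j. f)"

definition idempotent_completion :: "('o, 'b, 'k) lmcat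
    \<Rightarrow> ('o \<times> ('o, 'b) arrow, ('o, 'b) arrow, 'k) lmcat" where
  "idempotent_completion C = (let Ob = {(z, f). z \<in> objs C \<and> f \<in> hom C z z \<and> f \<cdot>\<^bsub>C\<^esub> f = f} in
    \<lparr> objs = Ob,
      arrs = {Arrow (z, f) (z', f') (f' \<cdot>\<^bsub>C\<^esub> g \<cdot>\<^bsub>C\<^esub> f) | z f z' f' g.
                (z, f) \<in> Ob \<and> (z', f') \<in> Ob \<and> g \<in> hom C z z'},
      ident = (\<lambda>(z, f). Arrow (z, f) (z, f) f),
      compose = (\<lambda>F G. Arrow (src G) (tgt F) (body F \<cdot>\<^bsub>C\<^esub> body G)),
      plus_arr = (\<lambda>F G. Arrow (src F) (tgt F) (body F \<oplus>\<^bsub>C\<^esub> body G)),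
      zero_arr = (\<lambda>(z, f) (z', f'). Arrow (z, f) (z', f') (zero_arr C z z')),
      scale_arr = (\<lambda>c F. Arrow (src F) (tgt F) (c \<odot>\<^bsub>C\<^esub> body F)),
      unit_obj = (unit_obj C, \<one>\<^bsub>C\<^esub> (unit_obj C)),
      tensor_obj = (\<lambda>(z, f) (z', f'). (z \<boxtimes>\<^bsub>C\<^esub> z', f \<otimes>\<^bsub>C\<^esub> f')),
      tensor_arr = (\<lambda>F G. Arrow
                (fst (src F) \<boxtimes>\<^bsub>C\<^esub> fst (src G), snd (src F) \<otimes>\<^bsub>C\<^esub> snd (src G))
                (fst (tgt F) \<boxtimes>\<^bsub>C\<^esub> fst (tgt G), snd (tgt F) \<otimes>\<^bsub>C\<^esub> snd (tgt G))
                (body F \<otimes>\<^bsub>C\<^esub> body G)) \<rparr>)"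

definition Kar :: "('o, 'b, 'k) lmcat
    \<Rightarrow> ('o list \<times> ('o list, nat \<times> nat \<Rightarrow> ('o, 'b) arrow) arrow,
        ('o list, nat \<times> nat \<Rightarrow> ('o, 'b) arrow) arrow, 'k) lmcat" where
  "Kar C = idempotent_completion (additive_envelope C)"


section \<open>The category SL\<close>

datatype T_gen = Mul | Swap | Cup | Cap

primrec T_ar :: "T_gen \<Rightarrow> nat \<times> nat" where
  "T_ar Mul = (2, 1)"
| "T_ar Swap = (2, 2)"
| "T_ar Cup = (0, 2)"
| "T_ar Cap = (2, 0)"

abbreviation m\<^sub>t :: "(T_gen, 'k) trm" where "m\<^sub>t \<equiv> Gen Mul"
abbreviation s\<^sub>t :: "(T_gen, 'k) trm" where "s\<^sub>t \<equiv> Gen Swap"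
abbreviation \<eta>\<^sub>t :: "(T_gen, 'k) trm" where "\<eta>\<^sub>t \<equiv> Gen Cup"
abbreviation \<epsilon>\<^sub>t :: "(T_gen, 'k) trm" where "\<epsilon>\<^sub>t \<equiv> Gen Cap"
abbreviation I\<^sub>t :: "('g, 'k) trm" where "I\<^sub>t \<equiv> Idt 1"

definition \<sigma>\<^sub>t :: "(T_gen, 'k) trm" where
  "\<sigma>\<^sub>t = (I\<^sub>t \<otimes>\<^sub>t m\<^sub>t) \<circ>\<^sub>t (\<eta>\<^sub>t \<otimes>\<^sub>t I\<^sub>t)"

definition T_rels :: "'k::field \<Rightarrow> 'k \<Rightarrow> ((T_gen, 'k) trm \<times> (T_gen, 'k) trm) set" where
  "T_rels \<delta> \<alpha> =
   { ((\<epsilon>\<^sub>t \<otimes>\<^sub>t I\<^sub>t) \<circ>\<^sub>t (I\<^sub>t \<otimes>\<^sub>t \<eta>\<^sub>t), I\<^sub>t),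
     (I\<^sub>t, (I\<^sub>t \<otimes>\<^sub>t \<epsilon>\<^sub>t) \<circ>\<^sub>t (\<eta>\<^sub>t \<otimes>\<^sub>t I\<^sub>t)),
     (\<sigma>\<^sub>t, (m\<^sub>t \<otimes>\<^sub>t I\<^sub>t) \<circ>\<^sub>t (I\<^sub>t \<otimes>\<^sub>t \<eta>\<^sub>t)),
     ((I\<^sub>t \<otimes>\<^sub>t \<epsilon>\<^sub>t) \<circ>\<^sub>t (s\<^sub>t \<otimes>\<^sub>t I\<^sub>t), (\<epsilon>\<^sub>t \<otimes>\<^sub>t I\<^sub>t) \<circ>\<^sub>t (I\<^sub>t \<otimes>\<^sub>t s\<^sub>t)),
     (s\<^sub>t \<circ>\<^sub>t s\<^sub>t, I\<^sub>t \<otimes>\<^sub>t I\<^sub>t),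
     ((s\<^sub>t \<otimes>\<^sub>t I\<^sub>t) \<circ>\<^sub>t (I\<^sub>t \<otimes>\<^sub>t s\<^sub>t) \<circ>\<^sub>t (s\<^sub>t \<otimes>\<^sub>t I\<^sub>t),
      (I\<^sub>t \<otimes>\<^sub>t s\<^sub>t) \<circ>\<^sub>t (s\<^sub>t \<otimes>\<^sub>t I\<^sub>t) \<circ>\<^sub>t (I\<^sub>t \<otimes>\<^sub>t s\<^sub>t)),
     ((I\<^sub>t \<otimes>\<^sub>t m\<^sub>t) \<circ>\<^sub>t (s\<^sub>t \<otimes>\<^sub>t I\<^sub>t) \<circ>\<^sub>t (I\<^sub>t \<otimes>\<^sub>t s\<^sub>t), s\<^sub>t \<circ>\<^sub>t (m\<^sub>t \<otimes>\<^sub>t I\<^sub>t)),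
     ((I\<^sub>t \<otimes>\<^sub>t s\<^sub>t) \<circ>\<^sub>t (s\<^sub>t \<otimes>\<^sub>t I\<^sub>t) \<circ>\<^sub>t (I\<^sub>t \<otimes>\<^sub>t \<sigma>\<^sub>t), (\<sigma>\<^sub>t \<otimes>\<^sub>t I\<^sub>t) \<circ>\<^sub>t s\<^sub>t),
     (\<epsilon>\<^sub>t \<circ>\<^sub>t s\<^sub>t, \<epsilon>\<^sub>t),
     (m\<^sub>t \<circ>\<^sub>t s\<^sub>t, (- 1) *\<^sub>t m\<^sub>t),
     (m\<^sub>t \<circ>\<^sub>t \<sigma>\<^sub>t, \<alpha> *\<^sub>t I\<^sub>t),
     (\<epsilon>\<^sub>t \<circ>\<^sub>t \<eta>\<^sub>t, \<delta> *\<^sub>t Idt 0) }"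

definition T_cat :: "'k::field \<Rightarrow> 'k \<Rightarrow> (nat, (T_gen, 'k) trm set, 'k) lmcat" where
  "T_cat \<delta> \<alpha> = presented T_ar (T_rels \<delta> \<alpha>)"

definition K\<^sub>t :: "(T_gen, 'k) trm" where
  "K\<^sub>t = \<sigma>\<^sub>t \<circ>\<^sub>t m\<^sub>t"

text \<open>By the relation involving \<open>\<sigma>\<^sub>t\<close> in \<open>T_rels\<close> and interchange, this also equals
  \<open>(I\<^sub>t \<otimes>\<^sub>t m\<^sub>t) \<circ>\<^sub>t (\<sigma>\<^sub>t \<otimes>\<^sub>t I\<^sub>t)\<close>.\<close>
definition H\<^sub>t :: "(T_gen, 'k) trm" where
  "H\<^sub>t = (m\<^sub>t \<otimes>\<^sub>t I\<^sub>t) \<circ>\<^sub>t (I\<^sub>t \<otimes>\<^sub>t \<sigma>\<^sub>t)"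

definition D\<^sub>t :: "(T_gen, 'k) trm" where
  "D\<^sub>t = (m\<^sub>t \<otimes>\<^sub>t I\<^sub>t) \<circ>\<^sub>t (I\<^sub>t \<otimes>\<^sub>t s\<^sub>t) \<circ>\<^sub>t (\<sigma>\<^sub>t \<otimes>\<^sub>t I\<^sub>t)"

text \<open>The differences of the two sides of \<open>D = K - H\<close> and of \<open>K = 1/2 (1 - s)\<close>, as
  morphisms of \<open>T_cat 3 1\<close>.\<close>
definition SL_ideal :: "(nat, (T_gen, 'k::field) trm set) arrow set" where
  "SL_ideal = tensor_ideal (T_cat 3 1)
    { tclass T_ar (T_rels 3 1) (D\<^sub>t +\<^sub>t (- 1) *\<^sub>t (K\<^sub>t +\<^sub>t (- 1) *\<^sub>t H\<^sub>t)),
      tclass T_ar (T_rels 3 1)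
        (K\<^sub>t +\<^sub>t (- 1) *\<^sub>t (1 / 2) *\<^sub>t (I\<^sub>t \<otimes>\<^sub>t I\<^sub>t +\<^sub>t (- 1) *\<^sub>t s\<^sub>t)) }"

definition SL :: "(nat, (nat, (T_gen, 'k::field) trm set) arrow set, 'k) lmcat" where
  "SL = quotient_cat (T_cat 3 1) SL_ideal"

definition SL_gen :: "T_gen \<Rightarrow> (nat, (nat, (T_gen, 'k::field) trm set) arrow set) arrow" where
  "SL_gen g = coset (T_cat 3 1) SL_ideal (tclass T_ar (T_rels 3 1) (Gen g))"

definition X_obj :: nat where "X_obj = 1"


section \<open>The Temperley--Lieb category\<close>

datatype TL_gen = TL_Cup | TL_Cap

primrec TL_ar :: "TL_gen \<Rightarrow> nat \<times> nat" where
  "TL_ar TL_Cup = (0, 2)"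
| "TL_ar TL_Cap = (2, 0)"

definition TL_rels :: "'k::field \<Rightarrow> ((TL_gen, 'k) trm \<times> (TL_gen, 'k) trm) set" where
  "TL_rels \<delta> =
   { ((Gen TL_Cap \<otimes>\<^sub>t I\<^sub>t) \<circ>\<^sub>t (I\<^sub>t \<otimes>\<^sub>t Gen TL_Cup), I\<^sub>t),
     (I\<^sub>t, (I\<^sub>t \<otimes>\<^sub>t Gen TL_Cap) \<circ>\<^sub>t (Gen TL_Cup \<otimes>\<^sub>t I\<^sub>t)),
     (Gen TL_Cap \<circ>\<^sub>t Gen TL_Cup, \<delta> *\<^sub>t Idt 0) }"

definition TL :: "'k::field \<Rightarrow> (nat, (TL_gen, 'k) trm set, 'k) lmcat" where
  "TL \<delta> = presented TL_ar (TL_rels \<delta>)"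

abbreviation TL_minus2 :: "(nat, (TL_gen, 'k::field) trm set, 'k) lmcat"  (\<open>\<T>\<close>) where
  "\<T> \<equiv> TL (- 2)"

definition Y_obj :: nat where "Y_obj = 1"

definition \<eta>\<^sub>Y :: "(nat, (TL_gen, 'k::field) trm set) arrow" where
  "\<eta>\<^sub>Y = tclass TL_ar (TL_rels (- 2)) (Gen TL_Cup)"

definition \<epsilon>\<^sub>Y :: "(nat, (TL_gen, 'k::field) trm set) arrow" where
  "\<epsilon>\<^sub>Y = tclass TL_ar (TL_rels (- 2)) (Gen TL_Cap)"

text \<open>\<open>Y_obj + Y_obj\<close> is the object \<open>Y \<otimes> Y\<close>, because \<open>tensor_obj\<close> of a presented category is addition.\<close>

definition s\<^sub>Y :: "(nat, (TL_gen, 'k::field) trm set) arrow" where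
  "s\<^sub>Y = \<one>\<^bsub>\<T>\<^esub> (Y_obj + Y_obj) \<oplus>\<^bsub>\<T>\<^esub> \<eta>\<^sub>Y \<cdot>\<^bsub>\<T>\<^esub> \<epsilon>\<^sub>Y"

definition e\<^sub>Y :: "(nat, (TL_gen, 'k::field) trm set) arrow" where
  "e\<^sub>Y = (1 / 2) \<odot>\<^bsub>\<T>\<^esub> (\<one>\<^bsub>\<T>\<^esub> (Y_obj + Y_obj) \<oplus>\<^bsub>\<T>\<^esub> s\<^sub>Y)"

text \<open>The object \<open>(Y \<otimes> Y, e)\<close> of the additive Karoubi envelope.\<close>

definition X_image :: "nat list \<times> (nat list, nat \<times> nat \<Rightarrow> (nat, (TL_gen, 'k::field) trm set) arrow) arrow"
  where "X_image = ([Y_obj + Y_obj], add_incl e\<^sub>Y)"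

end

theory Submission
  imports Defs
begin

text \<open>
  The theorem is invariant theory of \<open>SL\<^sub>2\<close> in disguise.  In \<open>\<T>\<close> the object \<open>Y\<close> behaves like the
  two-dimensional representation of \<open>SL\<^sub>2\<close>, with cup and cap given by the alternating form, so that
  \<open>e\<^sub>Y\<close> projects \<open>Y \<otimes> Y\<close> onto the symmetric square, which is the adjoint representation.  Under this
  dictionary \<open>\<epsilon>\<close> is an invariant symmetric form, \<open>s\<close> is the flip, and \<open>m\<close> is a multiple of the Lie
  bracket; the factor \<open>i\<close> is there because the bracket built from \<open>\<epsilon>\<^sub>Y\<close> alone would give
  \<open>m \<sigma> = - 1\<close> instead of \<open>m \<sigma> = 1\<close>.  The relations of \<open>SL\<close> are then identities satisfied by the
  three-dimensional simple Lie algebra.  A field of positive characteristic is allowed, so the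
  proof does not pass through representations and derives everything from the relations of \<open>\<T>\<close>.

  \<^emph>\<open>Existence.\<close>  A term \<open>t\<close> built from the generators of \<open>SL\<close> is sent to a morphism \<open>img t\<close>
  of \<open>\<T>\<close>, where the identity of the \<open>n\<close>-th power of \<open>X\<close> goes to the \<open>n\<close>-th tensor power of \<open>e\<^sub>Y\<close>.
  Every \<open>img t\<close> absorbs these idempotents on both sides (\<open>img_absorb\<close>), hence is a morphism of
  the Karoubi envelope between the images of the powers of \<open>X\<close>.  The assignment respects provable
  equality of terms (\<open>img_teq\<close>) and kills the tensor ideal (\<open>img_arrow_ideal\<close>) as soon as the
  twelve relations of \<open>T_rels\<close> and the two relations generating the ideal hold for the images.

  These fourteen identities are verified by calculation.  Each morphism of \<open>\<T>\<close> is a linear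
  combination of words whose letters insert a cup, or a cap, at a given position.  The relations
  of \<open>\<T>\<close> let a cap on the left of a word travel to the right until it closes a loop, straightens
  a zigzag, or arrives among the other caps.  The function \<open>act\<close> reduces combinations in this way,
  and \<open>interp_eqI\<close> says that two terms are equal in \<open>\<T>\<close> if their difference reduces to the empty
  combination.  All coefficients that occur are of the form \<open>(a + b i) / 2\<^sup>k\<close> with integers \<open>a\<close>,
  \<open>b\<close>, so that one calculation in integers covers all fields in which \<open>2\<close> is invertible.

  \<^emph>\<open>Uniqueness.\<close>  A linear monoidal functor on \<open>SL\<close> is determined by the images of \<open>X\<close> and of
  the four generating morphisms (\<open>functor_unique\<close>).  The image of \<open>\<eta>\<close> is not prescribed, but a
  copairing is determined by the pairing to which it is dual (\<open>cup_unique\<close>).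
\<close>

section \<open>Equational reasoning in a presented category\<close>

lemma teq_wft: "teq ar R t u \<Longrightarrow> wft ar t \<and> wft ar u \<and> tdom ar t = tdom ar u \<and> tcod ar t = tcod ar u"
  by (induction rule: teq.induct) auto

text \<open>
  The congruence \<open>teq\<close> relates terms, but equational reasoning is smoother with equalities
  between arrows.  The lemmas of this locale restate the axioms of strict linear monoidal
  categories in that form, with side conditions on sources and targets that the simplifier can
  discharge.
\<close>

locale presentation =
  fixes ar :: "'g \<Rightarrow> nat \<times> nat" and R :: "(('g, 'k::field) trm \<times> ('g, 'k) trm) set"
    and C :: "(nat, ('g, 'k) trm set, 'k) lmcat"  (structure)
  assumes C_def: "C = presented ar R"
begin

abbreviation q :: "('g, 'k) trm \<Rightarrow> (nat, ('g, 'k) trm set) arrow" where "q \<equiv> tclass ar R"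

lemma src_class [simp]: "src (q t) = tdom ar t" and tgt_class [simp]: "tgt (q t) = tcod ar t"
  by (simp_all add: tclass_def)

lemma objs_eq [simp]: "objs C = UNIV"
  by (simp add: C_def presented_def)

lemma unit_obj_eq [simp]: "unit_obj C = 0"
  by (simp add: C_def presented_def)

lemma tensor_obj_eq [simp]: "a \<boxtimes> b = a + b"
  by (simp add: C_def presented_def)

lemma arrs_iff: "f \<in> arrs C \<longleftrightarrow> (\<exists>t. wft ar t \<and> f = q t)"
  by (auto simp: C_def presented_def)

lemma arrsE: assumes "f \<in> arrs C" obtains t where "wft ar t" "f = q t"
  using assms by (auto simp: arrs_iff)

lemma class_in_arrs [simp]: "wft ar t \<Longrightarrow> q t \<in> arrs C"
  by (auto simp: arrs_iff)

lemma class_eqI: "teq ar R t u \<Longrightarrow> q t = q u"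
  using teq_wft[of ar R t u] by (auto simp: tclass_def intro: teq.sym teq.trans)

lemma rep_class: "wft ar t \<Longrightarrow> teq ar R t (rep (q t))"
  unfolding rep_def using someI[of "\<lambda>f. f \<in> body (q t)" t] teq.refl[of ar t R]
  by (simp add: tclass_def)

lemma rep_class_wft [simp]:
  assumes "wft ar t"
  shows "wft ar (rep (q t))" "tdom ar (rep (q t)) = tdom ar t" "tcod ar (rep (q t)) = tcod ar t"
  using teq_wft[OF rep_class[OF assms]] by auto

lemma ident_eq: "\<one> n = q (Idt n)"
  by (simp add: C_def presented_def)

lemma zero_eq: "zero_arr C m n = q (Zer m n)"
  by (simp add: C_def presented_def)

lemma comp_class: "wft ar (t \<circ>\<^sub>t u) \<Longrightarrow> q t \<cdot> q u = q (t \<circ>\<^sub>t u)"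
  by (simp add: C_def presented_def)
    (intro class_eqI teq.cmp_cong teq.sym[OF rep_class], auto)

lemma tensor_class: "wft ar (t \<otimes>\<^sub>t u) \<Longrightarrow> q t \<otimes> q u = q (t \<otimes>\<^sub>t u)"
  by (simp add: C_def presented_def)
    (intro class_eqI teq.tns_cong teq.sym[OF rep_class], auto)

lemma plus_class: "wft ar (t +\<^sub>t u) \<Longrightarrow> q t \<oplus> q u = q (t +\<^sub>t u)"
  by (simp add: C_def presented_def)
    (intro class_eqI teq.pls_cong teq.sym[OF rep_class], auto)

lemma scale_class: "wft ar t \<Longrightarrow> c \<odot> q t = q (c *\<^sub>t t)"
  by (simp add: C_def presented_def)
    (intro class_eqI teq.scl_cong teq.sym[OF rep_class], auto)

lemmas ops_class = ident_eq zero_eq comp_class tensor_class plus_class scale_class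

lemma ident_arr [simp]: "\<one> n \<in> arrs C" "src (\<one> n) = n" "tgt (\<one> n) = n"
  by (simp_all add: ident_eq)

lemma zero_arr [simp]: "zero_arr C m n \<in> arrs C" "src (zero_arr C m n) = m" "tgt (zero_arr C m n) = n"
  by (simp_all add: zero_eq)

lemma comp_arr [simp]:
  assumes "f \<in> arrs C" "g \<in> arrs C" "src f = tgt g"
  shows "f \<cdot> g \<in> arrs C" "src (f \<cdot> g) = src g" "tgt (f \<cdot> g) = tgt f"
  using assms by (auto simp: comp_class elim!: arrsE)

lemma tensor_arr [simp]:
  assumes "f \<in> arrs C" "g \<in> arrs C"
  shows "f \<otimes> g \<in> arrs C" "src (f \<otimes> g) = src f + src g" "tgt (f \<otimes> g) = tgt f + tgt g"
  using assms by (auto simp: tensor_class elim!: arrsE)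

lemma plus_arr [simp]:
  assumes "f \<in> arrs C" "g \<in> arrs C" "src f = src g" "tgt f = tgt g"
  shows "f \<oplus> g \<in> arrs C" "src (f \<oplus> g) = src g" "tgt (f \<oplus> g) = tgt g"
  using assms by (auto simp: plus_class elim!: arrsE)

lemma scale_arr [simp]:
  assumes "f \<in> arrs C"
  shows "c \<odot> f \<in> arrs C" "src (c \<odot> f) = src f" "tgt (c \<odot> f) = tgt f"
  using assms by (auto simp: scale_class elim!: arrsE)

lemma comp_ident [simp]:
  assumes "f \<in> arrs C"
  shows "tgt f = n \<Longrightarrow> \<one> n \<cdot> f = f" and "src f = n \<Longrightarrow> f \<cdot> \<one> n = f"
  using assms by (auto simp: ops_class elim!: arrsE intro!: class_eqI teq.cmp_id_left teq.cmp_id_right)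

lemma comp_assoc:
  assumes "f \<in> arrs C" "g \<in> arrs C" "h \<in> arrs C" "src f = tgt g" "src g = tgt h"
  shows "(f \<cdot> g) \<cdot> h = f \<cdot> g \<cdot> h"
  using assms by (auto simp: ops_class elim!: arrsE intro!: class_eqI teq.cmp_assoc)

lemma tensor_unit [simp]:
  assumes "f \<in> arrs C"
  shows "\<one> 0 \<otimes> f = f" and "f \<otimes> \<one> 0 = f"
  using assms by (auto simp: ops_class elim!: arrsE intro!: class_eqI teq.tns_unit_left teq.tns_unit_right)

lemma tensor_assoc:
  assumes "f \<in> arrs C" "g \<in> arrs C" "h \<in> arrs C"
  shows "(f \<otimes> g) \<otimes> h = f \<otimes> g \<otimes> h"
  using assms by (auto simp: ops_class elim!: arrsE intro!: class_eqI teq.tns_assoc)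

lemma tensor_ident: "\<one> m \<otimes> \<one> n = \<one> (m + n)"
  by (auto simp: ops_class intro!: class_eqI teq.tns_id)

lemma interchange:
  assumes "f \<in> arrs C" "g \<in> arrs C" "h \<in> arrs C" "k \<in> arrs C" "src f = tgt h" "src g = tgt k"
  shows "(f \<otimes> g) \<cdot> (h \<otimes> k) = (f \<cdot> h) \<otimes> (g \<cdot> k)"
  using assms by (auto simp: ops_class elim!: arrsE intro!: class_eqI teq.interchange)

lemma plus_assoc:
  assumes "f \<in> arrs C" "g \<in> arrs C" "h \<in> arrs C" "src f = src g" "tgt f = tgt g" "src g = src h" "tgt g = tgt h"
  shows "(f \<oplus> g) \<oplus> h = f \<oplus> (g \<oplus> h)"
  using assms by (auto simp: ops_class elim!: arrsE intro!: class_eqI teq.pls_assoc)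

lemma plus_commute:
  assumes "f \<in> arrs C" "g \<in> arrs C" "src f = src g" "tgt f = tgt g"
  shows "f \<oplus> g = g \<oplus> f"
  using assms by (auto simp: ops_class elim!: arrsE intro!: class_eqI teq.pls_commute)

lemma plus_zero_right [simp]:
  assumes "f \<in> arrs C" "src f = m" "tgt f = n"
  shows "f \<oplus> zero_arr C m n = f"
  using assms by (auto simp: ops_class elim!: arrsE intro!: class_eqI teq.pls_zero)

lemma plus_zero_left [simp]:
  assumes "f \<in> arrs C" "src f = m" "tgt f = n"
  shows "zero_arr C m n \<oplus> f = f"
  using assms plus_commute[of "zero_arr C m n" f] by simp

lemma plus_neg:
  assumes "f \<in> arrs C"
  shows "f \<oplus> (- 1) \<odot> f = zero_arr C (src f) (tgt f)"
  using assms by (auto simp: ops_class elim!: arrsE intro!: class_eqI teq.pls_neg)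

lemma scale_plus:
  assumes "f \<in> arrs C" "g \<in> arrs C" "src f = src g" "tgt f = tgt g"
  shows "c \<odot> (f \<oplus> g) = c \<odot> f \<oplus> c \<odot> g"
  using assms by (auto simp: ops_class elim!: arrsE intro!: class_eqI teq.scl_pls)

lemma plus_scale:
  assumes "f \<in> arrs C"
  shows "(c + d) \<odot> f = c \<odot> f \<oplus> d \<odot> f"
  using assms by (auto simp: ops_class elim!: arrsE intro!: class_eqI teq.pls_scl)

lemma scale_scale [simp]:
  assumes "f \<in> arrs C"
  shows "c \<odot> d \<odot> f = (c * d) \<odot> f"
  using assms by (auto simp: ops_class elim!: arrsE intro!: class_eqI teq.sym[OF teq.scl_scl])

lemma scale_one [simp]:
  assumes "f \<in> arrs C"
  shows "1 \<odot> f = f"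
  using assms by (auto simp: ops_class elim!: arrsE intro!: class_eqI teq.scl_one)

lemma comp_plus:
  assumes "f \<in> arrs C" "g \<in> arrs C" "h \<in> arrs C" "src f = src g" "tgt f = tgt g"
  shows comp_plus_left: "src f = tgt h \<Longrightarrow> (f \<oplus> g) \<cdot> h = f \<cdot> h \<oplus> g \<cdot> h"
    and comp_plus_right: "src h = tgt f \<Longrightarrow> h \<cdot> (f \<oplus> g) = h \<cdot> f \<oplus> h \<cdot> g"
  using assms
  by (auto simp: ops_class elim!: arrsE intro!: class_eqI teq.cmp_pls_left teq.cmp_pls_right)

lemma comp_scale [simp]:
  assumes "f \<in> arrs C" "g \<in> arrs C" "src f = tgt g"
  shows comp_scale_left: "(c \<odot> f) \<cdot> g = c \<odot> (f \<cdot> g)"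
    and comp_scale_right: "f \<cdot> (c \<odot> g) = c \<odot> (f \<cdot> g)"
  using assms
  by (auto simp: ops_class elim!: arrsE intro!: class_eqI teq.cmp_scl_left teq.cmp_scl_right)

lemma tensor_plus:
  assumes "f \<in> arrs C" "g \<in> arrs C" "h \<in> arrs C" "src f = src g" "tgt f = tgt g"
  shows tensor_plus_left: "(f \<oplus> g) \<otimes> h = f \<otimes> h \<oplus> g \<otimes> h"
    and tensor_plus_right: "h \<otimes> (f \<oplus> g) = h \<otimes> f \<oplus> h \<otimes> g"
  using assms
  by (auto simp: ops_class elim!: arrsE intro!: class_eqI teq.tns_pls_left teq.tns_pls_right)

lemma tensor_scale [simp]:
  assumes "f \<in> arrs C" "g \<in> arrs C"
  shows tensor_scale_left: "(c \<odot> f) \<otimes> g = c \<odot> (f \<otimes> g)"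
    and tensor_scale_right: "f \<otimes> (c \<odot> g) = c \<odot> (f \<otimes> g)"
  using assms
  by (auto simp: ops_class elim!: arrsE intro!: class_eqI teq.tns_scl_left teq.tns_scl_right)

lemma plus_eq_zeroD:
  assumes "f \<in> arrs C" "g \<in> arrs C" "src f = src g" "tgt f = tgt g"
    and "f \<oplus> (- 1) \<odot> g = zero_arr C (src g) (tgt g)"
  shows "f = g"
proof -
  have "f = f \<oplus> ((- 1) \<odot> g \<oplus> g)"
    using assms(1-4) plus_neg[of g] plus_commute[of "(- 1) \<odot> g" g] by simp
  also have "\<dots> = g"
    using assms plus_assoc[of f "(- 1) \<odot> g" g] by simp
  finally show ?thesis .
qed

lemma scale_zero [simp]:
  assumes "f \<in> arrs C"
  shows "0 \<odot> f = zero_arr C (src f) (tgt f)"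
  using plus_neg[OF assms] plus_scale[OF assms, of 1 "- 1"] assms by simp

lemma zero_ops [simp]:
  shows scale_zero_arr: "c \<odot> zero_arr C m n = zero_arr C m n"
    and comp_zero_left: "g \<in> arrs C \<Longrightarrow> tgt g = m \<Longrightarrow> zero_arr C m n \<cdot> g = zero_arr C (src g) n"
    and comp_zero_right: "g \<in> arrs C \<Longrightarrow> src g = n \<Longrightarrow> g \<cdot> zero_arr C m n = zero_arr C m (tgt g)"
    and tensor_zero_left: "g \<in> arrs C \<Longrightarrow> zero_arr C m n \<otimes> g = zero_arr C (m + src g) (n + tgt g)"
    and tensor_zero_right: "g \<in> arrs C \<Longrightarrow> g \<otimes> zero_arr C m n = zero_arr C (src g + m) (tgt g + n)"
  using scale_scale[of "zero_arr C m n" c 0] scale_zero[of "zero_arr C m n"]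
    comp_scale[of "zero_arr C m n" g 0] comp_scale[of g "zero_arr C m n" 0]
    tensor_scale[of "zero_arr C m n" g 0] tensor_scale[of g "zero_arr C m n" 0]
  by simp_all

end

context presentation begin

definition layer :: "nat \<Rightarrow> (nat, ('g, 'k) trm set) arrow \<Rightarrow> nat \<Rightarrow> (nat, ('g, 'k) trm set) arrow"
  where "layer a f b = \<one> a \<otimes> f \<otimes> \<one> b"

lemma layer_arr [simp]:
  assumes "f \<in> arrs C"
  shows "layer a f b \<in> arrs C" "src (layer a f b) = a + src f + b" "tgt (layer a f b) = a + tgt f + b"
  using assms by (simp_all add: layer_def)

lemma layer_0_0 [simp]: "f \<in> arrs C \<Longrightarrow> layer 0 f 0 = f"
  by (simp add: layer_def)

lemma layer_ident [simp]: "layer a (\<one> n) b = \<one> (a + n + b)"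
  by (simp add: layer_def tensor_ident add.assoc)

lemma layer_comp:
  assumes "f \<in> arrs C" "g \<in> arrs C" "src f = tgt g"
  shows "layer a (f \<cdot> g) b = layer a f b \<cdot> layer a g b"
  using assms by (simp add: layer_def interchange)

lemma layer_plus:
  assumes "f \<in> arrs C" "g \<in> arrs C" "src f = src g" "tgt f = tgt g"
  shows "layer a (f \<oplus> g) b = layer a f b \<oplus> layer a g b"
  using assms by (simp add: layer_def tensor_plus)

lemma layer_scale [simp]: "f \<in> arrs C \<Longrightarrow> layer a (c \<odot> f) b = c \<odot> layer a f b"
  by (simp add: layer_def)

lemma layer_zero [simp]: "layer a (zero_arr C m n) b = zero_arr C (a + m + b) (a + n + b)"
  by (simp add: layer_def add.assoc)

text \<open>
  Two morphisms that occupy disjoint strands commute.  The positions of \<open>f\<close> and \<open>g\<close> are \<open>k\<close> strands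
  apart, and \<open>g\<close> lies to the right of \<open>f\<close>, so only the position of \<open>g\<close> changes, by the difference of
  the number of outputs and inputs of \<open>f\<close>.
\<close>

lemma layer_far:
  assumes "f \<in> arrs C" "g \<in> arrs C"
  shows "layer a f (k + tgt g + b) \<cdot> layer (a + src f + k) g b
       = layer (a + tgt f + k) g b \<cdot> layer a f (k + src g + b)"
  using assms by (simp add: layer_def tensor_assoc interchange flip: tensor_ident)

lemma layer_tensor:
  assumes "f \<in> arrs C" "g \<in> arrs C"
  shows "layer a (f \<otimes> g) b = layer a f (tgt g + b) \<cdot> layer (a + src f) g b"
  using assms by (simp add: layer_def tensor_assoc interchange flip: tensor_ident)

end

section \<open>Words of cups and caps in the Temperley--Lieb category\<close>

global_interpretation TL: presentation TL_ar "TL_rels (- 2)" "TL (- 2)"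
  by unfold_locales (simp add: TL_def)

lemma cup_cap_arr [simp]:
  "\<eta>\<^sub>Y \<in> arrs \<T>" "src \<eta>\<^sub>Y = 0" "tgt \<eta>\<^sub>Y = 2" "\<epsilon>\<^sub>Y \<in> arrs \<T>" "src \<epsilon>\<^sub>Y = 2" "tgt \<epsilon>\<^sub>Y = 0"
  by (simp_all add: \<eta>\<^sub>Y_def \<epsilon>\<^sub>Y_def)

text \<open>
  The letters \<open>U a\<close> and \<open>A a\<close> insert a cup, respectively a cap, at position \<open>a\<close>; the head of a word
  is the letter applied last.  Words carry no number of strands to the right, so the same word
  acts on any number of strands that is large enough.  This makes a tensor factor on the right
  invisible, and a tensor factor on the left a mere shift of positions.
\<close>

datatype letter = U nat | A nat

fun word_cod :: "nat \<Rightarrow> letter list \<Rightarrow> nat" where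
  "word_cod m [] = m"
| "word_cod m (U a # w) = word_cod m w + 2"
| "word_cod m (A a # w) = word_cod m w - 2"

fun word_valid :: "nat \<Rightarrow> letter list \<Rightarrow> bool" where
  "word_valid m [] \<longleftrightarrow> True"
| "word_valid m (U a # w) \<longleftrightarrow> word_valid m w \<and> a \<le> word_cod m w"
| "word_valid m (A a # w) \<longleftrightarrow> word_valid m w \<and> a + 2 \<le> word_cod m w"

text \<open>
  \<open>cup_word a w\<close> and \<open>cap_word a w\<close> bring \<open>U a # w\<close> and \<open>A a # w\<close> into a standard form, provided that
  \<open>w\<close> is in standard form: first the cups with decreasing positions, then the caps with
  increasing positions.  The flag returned by \<open>cap_word\<close> records whether a loop was closed, which
  costs a factor \<open>- 2\<close>.  The shifts by two account for the strands that the letter passed over adds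
  or removes.
\<close>

fun cup_word :: "nat \<Rightarrow> letter list \<Rightarrow> letter list" where
  "cup_word a (U b # w) = (if a \<le> b then U (b + 2) # cup_word a w else U a # U b # w)"
| "cup_word a w = U a # w"

fun cap_word :: "nat \<Rightarrow> letter list \<Rightarrow> bool \<times> letter list" where
  "cap_word a [] = (False, [A a])"
| "cap_word a (U b # w) =
    (if a = b then (True, w)
     else if b = Suc a \<or> a = Suc b then (False, w)
     else if a < b then map_prod id (cup_word (b - 2)) (cap_word a w)
     else map_prod id (cup_word b) (cap_word (a - 2) w))"
| "cap_word a (A b # w) = (if b \<le> a then map_prod id ((#) (A b)) (cap_word (a + 2) w)
     else (False, A a # A b # w))"

text \<open>
  The idempotent \<open>e\<^sub>Y\<close> needs one half as a scalar, and the image of \<open>m\<close> a square root of \<open>- 1\<close>.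
\<close>

locale root_of_minus_one =
  fixes \<i> :: "'k::field"
  assumes two_nonzero: "(2::'k) \<noteq> 0" and i_square: "\<i> * \<i> = - 1"
begin

abbreviation cup :: "(nat, (TL_gen, 'k) trm set) arrow" where "cup \<equiv> \<eta>\<^sub>Y"
abbreviation cap :: "(nat, (TL_gen, 'k) trm set) arrow" where "cap \<equiv> \<epsilon>\<^sub>Y"
abbreviation qY :: "(TL_gen, 'k) trm \<Rightarrow> (nat, (TL_gen, 'k) trm set) arrow" where "qY \<equiv> TL.q"

lemma TL_class_eqI:
  assumes "(t, u) \<in> TL_rels (- 2)" "wft TL_ar t" "wft TL_ar u"
    "tdom TL_ar t = tdom TL_ar u" "tcod TL_ar t = tcod TL_ar u"
  shows "qY t = qY u"
  using assms by (intro TL.class_eqI teq.rel)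

lemma loop: "cap \<cdot>\<^bsub>\<T>\<^esub> cup = (- 2) \<odot>\<^bsub>\<T>\<^esub> \<one>\<^bsub>\<T>\<^esub> 0"
  using TL_class_eqI[of "Gen TL_Cap \<circ>\<^sub>t Gen TL_Cup" "(- 2) *\<^sub>t Idt 0"]
  unfolding \<eta>\<^sub>Y_def \<epsilon>\<^sub>Y_def by (simp add: TL.ops_class) (simp add: TL_rels_def)

lemma zigzag_left: "(cap \<otimes>\<^bsub>\<T>\<^esub> \<one>\<^bsub>\<T>\<^esub> 1) \<cdot>\<^bsub>\<T>\<^esub> (\<one>\<^bsub>\<T>\<^esub> 1 \<otimes>\<^bsub>\<T>\<^esub> cup) = \<one>\<^bsub>\<T>\<^esub> 1"
  using TL_class_eqI[of "(Gen TL_Cap \<otimes>\<^sub>t I\<^sub>t) \<circ>\<^sub>t (I\<^sub>t \<otimes>\<^sub>t Gen TL_Cup)" "I\<^sub>t"]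
  unfolding \<eta>\<^sub>Y_def \<epsilon>\<^sub>Y_def by (simp add: TL.ops_class(1,3,4)) (simp add: TL_rels_def)

lemma zigzag_right: "(\<one>\<^bsub>\<T>\<^esub> 1 \<otimes>\<^bsub>\<T>\<^esub> cap) \<cdot>\<^bsub>\<T>\<^esub> (cup \<otimes>\<^bsub>\<T>\<^esub> \<one>\<^bsub>\<T>\<^esub> 1) = \<one>\<^bsub>\<T>\<^esub> 1"
  using TL_class_eqI[of "I\<^sub>t" "(I\<^sub>t \<otimes>\<^sub>t Gen TL_Cap) \<circ>\<^sub>t (Gen TL_Cup \<otimes>\<^sub>t I\<^sub>t)"]
  unfolding \<eta>\<^sub>Y_def \<epsilon>\<^sub>Y_def by (simp add: TL.ops_class(1,3,4)) (simp add: TL_rels_def)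

fun word_arr :: "nat \<Rightarrow> letter list \<Rightarrow> (nat, (TL_gen, 'k) trm set) arrow" where
  "word_arr m [] = \<one>\<^bsub>\<T>\<^esub> m"
| "word_arr m (U a # w) = TL.layer a cup (word_cod m w - a) \<cdot>\<^bsub>\<T>\<^esub> word_arr m w"
| "word_arr m (A a # w) = TL.layer a cap (word_cod m w - (a + 2)) \<cdot>\<^bsub>\<T>\<^esub> word_arr m w"

lemma word_arr_hom: "word_valid m w \<Longrightarrow> word_arr m w \<in> hom \<T> m (word_cod m w)"
  by (induction m w rule: word_cod.induct) (auto simp: hom_def)

lemma word_arr [simp]:
  assumes "word_valid m w"
  shows "word_arr m w \<in> arrs \<T>" "src (word_arr m w) = m" "tgt (word_arr m w) = word_cod m w"
  using word_arr_hom[OF assms] by (simp_all add: hom_def)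

text \<open>
  The next four lemmas are the far commutations, one for each of the ways in which a letter can
  pass another one while a word is brought into standard form.
\<close>

lemma cup_cup:
  assumes "word_valid m w" "a \<le> b" "b \<le> word_cod m w"
  shows "word_arr m (U a # U b # w) = word_arr m (U (b + 2) # U a # w)"
proof -
  obtain k r where "b = a + k" "word_cod m w = b + r" using assms by (metis le_iff_add)
  then show ?thesis
    using assms TL.layer_far[of cup cup a k r] by (simp add: add.commute add.left_commute flip: TL.comp_assoc)
qed

lemma cap_cap:
  assumes "word_valid m w" "b \<le> a" "a + 4 \<le> word_cod m w"
  shows "word_arr m (A a # A b # w) = word_arr m (A b # A (a + 2) # w)"
proof -
  obtain k r where "a = b + k" "word_cod m w = a + 4 + r" using assms by (metis le_iff_add)
  then show ?thesis
    using assms TL.layer_far[of cap cap b k r] by (simp add: add.commute add.left_commute flip: TL.comp_assoc)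
qed

lemma cap_cup_right:
  assumes "word_valid m w" "a + 2 \<le> b" "b \<le> word_cod m w"
  shows "word_arr m (A a # U b # w) = word_arr m (U (b - 2) # A a # w)"
proof -
  obtain k r where "b = a + 2 + k" "word_cod m w = b + r" using assms by (metis le_iff_add)
  then show ?thesis
    using assms TL.layer_far[of cap cup a k r] by (simp add: add.commute add.left_commute flip: TL.comp_assoc)
qed

lemma cap_cup_left:
  assumes "word_valid m w" "b + 2 \<le> a" "a \<le> word_cod m w"
  shows "word_arr m (A a # U b # w) = word_arr m (U b # A (a - 2) # w)"
proof -
  obtain k r where "a = b + 2 + k" "word_cod m w = a + r" using assms by (metis le_iff_add)
  then show ?thesis
    using assms TL.layer_far[of cup cap b k r] by (simp add: add.commute add.left_commute flip: TL.comp_assoc)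
qed

text \<open>
  A cap that meets a cup on the same two strands closes a loop; if they share exactly one strand,
  they form a zigzag.
\<close>

lemma cap_cup_loop:
  assumes "word_valid m w" "a \<le> word_cod m w"
  shows "word_arr m (A a # U a # w) = (- 2) \<odot>\<^bsub>\<T>\<^esub> word_arr m w"
  using assms loop by (simp flip: TL.comp_assoc TL.layer_comp)

lemma cap_cup_zigzag:
  assumes "word_valid m w" "Suc a \<le> word_cod m w"
  shows "word_arr m (A a # U (Suc a) # w) = word_arr m w"
    and "word_arr m (A (Suc a) # U a # w) = word_arr m w"
proof -
  obtain r where r: "word_cod m w = Suc a + r" using assms by (metis le_iff_add)
  have "TL.layer a cap (1 + r) \<cdot>\<^bsub>\<T>\<^esub> TL.layer (a + 1) cup r = TL.layer a (\<one>\<^bsub>\<T>\<^esub> 1) r"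
    using arg_cong[OF zigzag_left, of "\<lambda>f. TL.layer a f r"]
    by (simp add: TL.layer_comp TL.layer_tensor)
  then show "word_arr m (A a # U (Suc a) # w) = word_arr m w"
    using assms r by (simp flip: TL.comp_assoc)
  have "TL.layer (a + 1) cap r \<cdot>\<^bsub>\<T>\<^esub> TL.layer a cup (1 + r) = TL.layer a (\<one>\<^bsub>\<T>\<^esub> 1) r"
    using arg_cong[OF zigzag_right, of "\<lambda>f. TL.layer a f r"]
    by (simp add: TL.layer_comp TL.layer_tensor)
  then show "word_arr m (A (Suc a) # U a # w) = word_arr m w"
    using assms r by (simp flip: TL.comp_assoc)
qed

lemma cup_word:
  assumes "word_valid m w" "a \<le> word_cod m w"
  shows "word_valid m (cup_word a w) \<and> word_cod m (cup_word a w) = word_cod m w + 2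
    \<and> word_arr m (cup_word a w) = word_arr m (U a # w)"
  using assms
proof (induction a w rule: cup_word.induct)
  case (1 a b w)
  then show ?case
    by (cases "a \<le> b") (auto simp: cup_cup simp del: word_arr.simps(2), simp_all)
qed auto

end

section \<open>Reduction of linear combinations of words\<close>

text \<open>
  \<open>GDyad a b k\<close> stands for \<open>(a + b i) / 2\<^sup>k\<close>.  Fractions are kept unreduced: only addition,
  multiplication and the test for zero are needed, and each is correct without normalisation.
\<close>

datatype gdyad = GDyad int int nat

fun gd_plus :: "gdyad \<Rightarrow> gdyad \<Rightarrow> gdyad" where
  "gd_plus (GDyad a b k) (GDyad c d l) =
    (if k \<le> l then GDyad (2 ^ (l - k) * a + c) (2 ^ (l - k) * b + d) l
     else GDyad (a + 2 ^ (k - l) * c) (b + 2 ^ (k - l) * d) k)"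

fun gd_mult :: "gdyad \<Rightarrow> gdyad \<Rightarrow> gdyad" where
  "gd_mult (GDyad a b k) (GDyad c d l) = GDyad (a * c - b * d) (a * d + b * c) (k + l)"

fun gd_is_zero :: "gdyad \<Rightarrow> bool" where
  "gd_is_zero (GDyad a b k) \<longleftrightarrow> a = 0 \<and> b = 0"

fun gd_val :: "'k::field \<Rightarrow> gdyad \<Rightarrow> 'k" where
  "gd_val \<i> (GDyad a b k) = (of_int a + of_int b * \<i>) / 2 ^ k"

type_synonym combination = "(gdyad \<times> letter list) list"

text \<open>
  Combinations are kept sorted by word, so that like terms are collected by merging in linear
  time.  The order serves efficiency alone; what correctness rests on is that words which compare
  as \<open>Equal\<close> are equal.
\<close>

datatype comparison = Less | Equal | Greater

fun compare_nat :: "nat \<Rightarrow> nat \<Rightarrow> comparison" where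
  "compare_nat 0 0 = Equal"
| "compare_nat 0 (Suc n) = Less"
| "compare_nat (Suc m) 0 = Greater"
| "compare_nat (Suc m) (Suc n) = compare_nat m n"

fun compare_letter :: "letter \<Rightarrow> letter \<Rightarrow> comparison" where
  "compare_letter (U a) (U b) = compare_nat a b"
| "compare_letter (U a) (A b) = Less"
| "compare_letter (A a) (U b) = Greater"
| "compare_letter (A a) (A b) = compare_nat a b"

fun compare_word :: "letter list \<Rightarrow> letter list \<Rightarrow> comparison" where
  "compare_word [] [] = Equal"
| "compare_word [] (y # v) = Less"
| "compare_word (x # w) [] = Greater"
| "compare_word (x # w) (y # v) =
    (case compare_letter x y of Equal \<Rightarrow> compare_word w v | r \<Rightarrow> r)"

fun merge :: "combination \<Rightarrow> combination \<Rightarrow> combination" where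
  "merge [] q = q"
| "merge p [] = p"
| "merge ((c, w) # p) ((d, v) # q) = (case compare_word w v of
      Less \<Rightarrow> (c, w) # merge p ((d, v) # q)
    | Greater \<Rightarrow> (d, v) # merge ((c, w) # p) q
    | Equal \<Rightarrow> (let s = gd_plus c d in if gd_is_zero s then merge p q else (s, w) # merge p q))"

fun merge_pairs :: "combination list \<Rightarrow> combination list" where
  "merge_pairs (p # q # ps) = merge p q # merge_pairs ps"
| "merge_pairs ps = ps"

lemma length_merge_pairs: "length (merge_pairs ps) \<le> length ps"
  by (induction ps rule: merge_pairs.induct) auto

function merge_all :: "combination list \<Rightarrow> combination" where
  "merge_all [] = []"
| "merge_all [p] = p"
| "merge_all (p # q # ps) = merge_all (merge p q # merge_pairs ps)"
  by pat_completeness auto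
termination
  by (relation "measure length") (auto simp: le_imp_less_Suc length_merge_pairs)

definition collect :: "combination \<Rightarrow> combination" where
  "collect p = merge_all (map (\<lambda>x. [x]) p)"

text \<open>
  \<open>act a t p\<close> composes the term \<open>t\<close>, placed at position \<open>a\<close>, with the combination \<open>p\<close>.  Expanding
  one generator at a time and collecting like terms after each step keeps the combinations
  short: their length is bounded by the number of planar matchings, which for the largest case
  below, endomorphisms of the sixth power of \<open>Y\<close>, is 132.
\<close>

primrec act :: "nat \<Rightarrow> (TL_gen, gdyad) trm \<Rightarrow> combination \<Rightarrow> combination" where
  "act a (Gen g) p = collect (map (\<lambda>(c, w). case g of
      TL_Cup \<Rightarrow> (c, cup_word a w)
    | TL_Cap \<Rightarrow> (case cap_word a w of (loop, v) \<Rightarrow>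
        (if loop then gd_mult (GDyad (- 2) 0 0) c else c, v))) p)"
| "act a (Idt n) p = p"
| "act a (Zer m n) p = []"
| "act a (t \<circ>\<^sub>t u) p = act a t (act a u p)"
| "act a (t \<otimes>\<^sub>t u) p = act a t (act (a + tdom TL_ar t) u p)"
| "act a (t +\<^sub>t u) p = merge (act a t p) (act a u p)"
| "act a (c *\<^sub>t t) p = map (\<lambda>(d, w). (gd_mult c d, w)) (act a t p)"

definition valid :: "nat \<Rightarrow> nat \<Rightarrow> combination \<Rightarrow> bool" where
  "valid m n p \<longleftrightarrow> (\<forall>(c, w) \<in> set p. word_valid m w \<and> word_cod m w = n)"

lemma valid_simps [simp]:
  "valid m n []" "valid m n ((c, w) # p) \<longleftrightarrow> word_valid m w \<and> word_cod m w = n \<and> valid m n p"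
  by (auto simp: valid_def)

lemma valid_append [simp]: "valid m n (p @ q) \<longleftrightarrow> valid m n p \<and> valid m n q"
  by (auto simp: valid_def)

lemma compare_nat_Equal: "compare_nat m n = Equal \<Longrightarrow> m = n"
  by (induction m n rule: compare_nat.induct) auto

lemma compare_letter_Equal: "compare_letter x y = Equal \<Longrightarrow> x = y"
  by (cases x; cases y) (auto dest: compare_nat_Equal)

lemma compare_word_Equal: "compare_word w v = Equal \<Longrightarrow> w = v"
  by (induction w v rule: compare_word.induct)
    (auto split: comparison.splits dest: compare_letter_Equal)

lemma tdom_map_trm [simp]: "tdom ar (map_trm (\<lambda>x. x) f t) = tdom ar t"
  and tcod_map_trm [simp]: "tcod ar (map_trm (\<lambda>x. x) f t) = tcod ar t"
  and wft_map_trm [simp]: "wft ar (map_trm (\<lambda>x. x) f t) = wft ar t"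
proof -
  show d: "tdom ar (map_trm (\<lambda>x. x) f t) = tdom ar t" for t by (induction t) auto
  show c: "tcod ar (map_trm (\<lambda>x. x) f t) = tcod ar t" for t by (induction t) auto
  show "wft ar (map_trm (\<lambda>x. x) f t) = wft ar t" by (induction t) (auto simp: d c)
qed

context root_of_minus_one begin

text \<open>
  Induction along the word: as long as the cap meets letters that it does not interact with, one
  of the far commutations moves it one letter further to the right.
\<close>

lemma cap_word:
  assumes "word_valid m w" "a + 2 \<le> word_cod m w" "cap_word a w = (l, v)"
  shows "word_valid m v \<and> word_cod m v = word_cod m w - 2
    \<and> word_arr m (A a # w) = (if l then - 2 else 1) \<odot>\<^bsub>\<T>\<^esub> word_arr m v"
  using assms
proof (induction a w arbitrary: l v rule: cap_word.induct)
  case (1 a)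
  then show ?case by (auto simp: le_diff_conv2)
next
  case (2 a b w)
  consider "a = b" | "b = Suc a" | "a = Suc b" | "a + 2 \<le> b" | "b + 2 \<le> a" by linarith
  then show ?case
  proof cases
    case 1
    then show ?thesis using 2(3-5) cap_cup_loop[of m w a] by simp
  next
    case c: 2
    then show ?thesis using 2(3-5) cap_cup_zigzag(1)[of m w a] by simp
  next
    case c: 3
    then show ?thesis using 2(3-5) cap_cup_zigzag(2)[of m w b] by simp
  next
    case c: 4
    obtain v' where v': "cap_word a w = (l, v')" "v = cup_word (b - 2) v'"
      using 2(5) c by (cases "cap_word a w") auto
    have IH: "word_valid m v'" "word_cod m v' = word_cod m w - 2"
      "word_arr m (A a # w) = (if l then - 2 else 1) \<odot>\<^bsub>\<T>\<^esub> word_arr m v'"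
      using 2(1)[OF _ _ _ _ _ v'(1)] 2(3,4) c by auto
    have le: "b \<le> word_cod m w" using 2(3) by simp
    then have "word_arr m (A a # U b # w)
      = TL.layer (b - 2) cup (word_cod m w - 2 - (b - 2)) \<cdot>\<^bsub>\<T>\<^esub> word_arr m (A a # w)"
      using cap_cup_right[of m w a b] 2(3) c by simp
    also have "\<dots> = (if l then - 2 else 1) \<odot>\<^bsub>\<T>\<^esub> word_arr m (U (b - 2) # v')"
      using IH le c by simp
    finally show ?thesis
      using v' IH le c cup_word[of m v' "b - 2"] by simp
  next
    case c: 5
    obtain v' where v': "cap_word (a - 2) w = (l, v')" "v = cup_word b v'"
      using 2(5) c by (cases "cap_word (a - 2) w") auto
    have le: "b \<le> word_cod m w" "a \<le> word_cod m w" using 2(3,4) by auto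
    have IH: "word_valid m v'" "word_cod m v' = word_cod m w - 2"
      "word_arr m (A (a - 2) # w) = (if l then - 2 else 1) \<odot>\<^bsub>\<T>\<^esub> word_arr m v'"
      using 2(2)[OF _ _ _ _ _ v'(1)] 2(3,4) c by auto
    have "word_arr m (A a # U b # w)
      = TL.layer b cup (word_cod m w - 2 - b) \<cdot>\<^bsub>\<T>\<^esub> word_arr m (A (a - 2) # w)"
      using cap_cup_left[of m w b a] 2(3) c le by simp
    also have "\<dots> = (if l then - 2 else 1) \<odot>\<^bsub>\<T>\<^esub> word_arr m (U b # v')"
      using IH le c by simp
    finally show ?thesis
      using v' IH le c cup_word[of m v' b] by simp
  qed
next
  case (3 a b w)
  show ?case
  proof (cases "b \<le> a")
    case True
    obtain v' where v': "cap_word (a + 2) w = (l, v')" "v = A b # v'"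
      using 3(4) True by (cases "cap_word (a + 2) w") auto
    have le: "a + 4 \<le> word_cod m w" using 3(3) by simp
    have IH: "word_valid m v'" "word_cod m v' = word_cod m w - 2"
      "word_arr m (A (a + 2) # w) = (if l then - 2 else 1) \<odot>\<^bsub>\<T>\<^esub> word_arr m v'"
      using 3(1)[OF True _ _ v'(1)] 3(2) le by auto
    have "word_arr m (A a # A b # w)
      = TL.layer b cap (word_cod m w - 2 - (b + 2)) \<cdot>\<^bsub>\<T>\<^esub> word_arr m (A (a + 2) # w)"
      using cap_cap[of m w b a] 3(2) True le by simp
    also have "\<dots> = (if l then - 2 else 1) \<odot>\<^bsub>\<T>\<^esub> word_arr m (A b # v')"
      using IH le True by simp
    finally show ?thesis
      using v' IH le True by simp
  next
    case False
    then show ?thesis using 3(2-4) TL.scale_one[OF word_arr(1), of m "A a # A b # w"] by auto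
  qed
qed

abbreviation val :: "gdyad \<Rightarrow> 'k" where "val \<equiv> gd_val \<i>"

lemma val_plus: "val (gd_plus c d) = val c + val d"
proof -
  have *: "(x * 2 ^ j) / 2 ^ (k + j) = x / (2 ^ k :: 'k)" for x k j
    using two_nonzero by (simp add: power_add)
  obtain a b k a' b' k' where cd: "c = GDyad a b k" "d = GDyad a' b' k'"
    by (cases c; cases d) auto
  show ?thesis
  proof (cases "k \<le> k'")
    case True
    then obtain j where "k' = k + j" by (auto simp: le_iff_add)
    then show ?thesis
      using *[of "of_int a + of_int b * \<i>" j k] by (simp add: cd add_divide_distrib algebra_simps)
  next
    case False
    then obtain j where "k = k' + j" "j \<noteq> 0" by (metis nat_le_linear le_iff_add add_0_right)
    then show ?thesis
      using *[of "of_int a' + of_int b' * \<i>" j k'] by (simp add: cd add_divide_distrib algebra_simps)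
  qed
qed

lemma val_mult: "val (gd_mult c d) = val c * val d"
proof -
  have ii: "\<i> * (\<i> * x) = - x" for x
    by (simp add: i_square flip: mult.assoc)
  have "(a + b * \<i>) * (a' + b' * \<i>) = (a * a' - b * b') + (a * b' + b * a') * \<i>" for a b a' b'
    by (simp add: algebra_simps ii)
  then show ?thesis
    by (cases c; cases d) (simp add: power_add)
qed

lemma val_is_zero: "gd_is_zero c \<Longrightarrow> val c = 0"
  by (cases c) auto

abbreviation interp :: "(TL_gen, gdyad) trm \<Rightarrow> (nat, (TL_gen, 'k) trm set) arrow" where
  "interp t \<equiv> qY (map_trm (\<lambda>x. x) val t)"

fun lin :: "nat \<Rightarrow> nat \<Rightarrow> combination \<Rightarrow> (nat, (TL_gen, 'k) trm set) arrow" where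
  "lin m n [] = zero_arr \<T> m n"
| "lin m n ((c, w) # p) = val c \<odot>\<^bsub>\<T>\<^esub> word_arr m w \<oplus>\<^bsub>\<T>\<^esub> lin m n p"

lemma lin_hom: "valid m n p \<Longrightarrow> lin m n p \<in> hom \<T> m n"
  by (induction m n p rule: lin.induct) (auto simp: hom_def)

lemma lin_arr [simp]:
  assumes "valid m n p"
  shows "lin m n p \<in> arrs \<T>" "src (lin m n p) = m" "tgt (lin m n p) = n"
  using lin_hom[OF assms] by (auto simp: hom_def)

lemma lin_append:
  "valid m n p \<Longrightarrow> valid m n q \<Longrightarrow> lin m n (p @ q) = lin m n p \<oplus>\<^bsub>\<T>\<^esub> lin m n q"
  by (induction m n p rule: lin.induct) (auto simp: TL.plus_assoc)

lemma lin_merge: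
  "valid m n p \<Longrightarrow> valid m n q \<Longrightarrow>
    valid m n (merge p q) \<and> lin m n (merge p q) = lin m n p \<oplus>\<^bsub>\<T>\<^esub> lin m n q"
proof (induction p q rule: merge.induct)
  case (3 c w p d v q)
  let ?W = "val c \<odot>\<^bsub>\<T>\<^esub> word_arr m w" and ?V = "val d \<odot>\<^bsub>\<T>\<^esub> word_arr m v"
  have swap: "(f \<oplus>\<^bsub>\<T>\<^esub> lin m n p) \<oplus>\<^bsub>\<T>\<^esub> (?V \<oplus>\<^bsub>\<T>\<^esub> lin m n q)
      = (f \<oplus>\<^bsub>\<T>\<^esub> ?V) \<oplus>\<^bsub>\<T>\<^esub> (lin m n p \<oplus>\<^bsub>\<T>\<^esub> lin m n q)"
    if "f \<in> hom \<T> m n" for f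
  proof -
    have "lin m n p \<oplus>\<^bsub>\<T>\<^esub> (?V \<oplus>\<^bsub>\<T>\<^esub> lin m n q) = ?V \<oplus>\<^bsub>\<T>\<^esub> (lin m n p \<oplus>\<^bsub>\<T>\<^esub> lin m n q)"
      using 3(5,6) TL.plus_commute[of "lin m n p" ?V] by (simp flip: TL.plus_assoc)
    then show ?thesis
      using that 3(5,6) by (simp add: TL.plus_assoc hom_def)
  qed
  have W: "?W \<in> hom \<T> m n" using 3(5) by (simp add: hom_def)
  show ?case
  proof (cases "compare_word w v")
    case Less
    then show ?thesis
      using 3 by (simp add: TL.plus_assoc)
  next
    case Greater
    have "?V \<oplus>\<^bsub>\<T>\<^esub> ((?W \<oplus>\<^bsub>\<T>\<^esub> lin m n p) \<oplus>\<^bsub>\<T>\<^esub> lin m n q)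
      = (?W \<oplus>\<^bsub>\<T>\<^esub> lin m n p) \<oplus>\<^bsub>\<T>\<^esub> (?V \<oplus>\<^bsub>\<T>\<^esub> lin m n q)"
      using 3(5,6) TL.plus_commute[of ?V "?W \<oplus>\<^bsub>\<T>\<^esub> lin m n p"] by (simp flip: TL.plus_assoc)
    then show ?thesis
      using 3(4)[OF Greater] 3(5,6) Greater by simp
  next
    case Equal
    then have "w = v" by (rule compare_word_Equal)
    then have "?W \<oplus>\<^bsub>\<T>\<^esub> ?V = val (gd_plus c d) \<odot>\<^bsub>\<T>\<^esub> word_arr m v"
      using 3(5,6) by (simp add: val_plus TL.plus_scale)
    then show ?thesis
      using swap[OF W] Equal \<open>w = v\<close> 3 by (auto simp: Let_def val_is_zero)
  qed
qed auto

lemma lin_merge_pairs: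
  "valid m n (concat ps) \<Longrightarrow> valid m n (concat (merge_pairs ps)) \<and>
    lin m n (concat (merge_pairs ps)) = lin m n (concat ps)"
proof (induction ps rule: merge_pairs.induct)
  case (1 p q ps)
  then show ?case
    using lin_merge[of m n p q] by (simp add: lin_append TL.plus_assoc)
qed auto

lemma lin_merge_all:
  "valid m n (concat ps) \<Longrightarrow>
    valid m n (merge_all ps) \<and> lin m n (merge_all ps) = lin m n (concat ps)"
proof (induction ps rule: merge_all.induct)
  case (3 p q ps)
  then show ?case
    using lin_merge_pairs[of m n "p # q # ps"] by simp
qed auto

lemma lin_collect: "valid m n p \<Longrightarrow> valid m n (collect p) \<and> lin m n (collect p) = lin m n p"
proof -
  have "concat (map (\<lambda>x. [x]) p) = p" by (induction p) auto
  then show "valid m n p \<Longrightarrow> valid m n (collect p) \<and> lin m n (collect p) = lin m n p"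
    using lin_merge_all[of m n "map (\<lambda>x. [x]) p"] by (simp add: collect_def)
qed

lemma lin_map:
  assumes "valid m n p" "f \<in> arrs \<T>" "src f = n" "tgt f = n'"
    and "\<And>c w. word_valid m w \<Longrightarrow> word_cod m w = n \<Longrightarrow>
      valid m n' [h (c, w)] \<and> lin m n' [h (c, w)] = val c \<odot>\<^bsub>\<T>\<^esub> (f \<cdot>\<^bsub>\<T>\<^esub> word_arr m w)"
  shows "valid m n' (map h p) \<and> lin m n' (map h p) = f \<cdot>\<^bsub>\<T>\<^esub> lin m n p"
  using assms(1)
proof (induction p)
  case Nil
  then show ?case using assms(2-4) by simp
next
  case (Cons x p)
  obtain c w where x: "x = (c, w)" by fastforce
  obtain d v where h: "h (c, w) = (d, v)" by fastforce
  show ?case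
    using Cons assms(2-4) assms(5)[of w c] by (auto simp: x h TL.comp_plus)
qed

text \<open>
  \<open>b\<close> is the number of strands to the right, which \<open>act\<close> does not see.  In a tensor product \<open>t \<otimes> u\<close>
  the right factor acts first, when the strands of \<open>t\<close> are still its inputs; this is why \<open>act\<close>
  shifts \<open>u\<close> by the domain of \<open>t\<close>.
\<close>

lemma act:
  assumes "wft TL_ar t" "valid m (a + tdom TL_ar t + b) p"
  shows "valid m (a + tcod TL_ar t + b) (act a t p) \<and>
    lin m (a + tcod TL_ar t + b) (act a t p)
      = TL.layer a (interp t) b \<cdot>\<^bsub>\<T>\<^esub> lin m (a + tdom TL_ar t + b) p"
  using assms
proof (induction t arbitrary: a b p)
  case (Gen g)
  define h where "h = (\<lambda>(c, w). case g of
      TL_Cup \<Rightarrow> (c, cup_word a w)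
    | TL_Cap \<Rightarrow> (case cap_word a w of (loop, v) \<Rightarrow>
        (if loop then gd_mult (GDyad (- 2) 0 0) c else c, v)))"
  have "valid m (a + snd (TL_ar g) + b) (map h p) \<and>
    lin m (a + snd (TL_ar g) + b) (map h p)
      = TL.layer a (interp (Gen g)) b \<cdot>\<^bsub>\<T>\<^esub> lin m (a + fst (TL_ar g) + b) p"
  proof (rule lin_map)
    fix c w assume w: "word_valid m w" "word_cod m w = a + fst (TL_ar g) + b"
    obtain l v where lv: "cap_word a w = (l, v)" by fastforce
    show "valid m (a + snd (TL_ar g) + b) [h (c, w)] \<and>
      lin m (a + snd (TL_ar g) + b) [h (c, w)]
        = val c \<odot>\<^bsub>\<T>\<^esub> (TL.layer a (interp (Gen g)) b \<cdot>\<^bsub>\<T>\<^esub> word_arr m w)"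
    proof (cases g)
      case TL_Cup
      then show ?thesis
        using cup_word[of m w a] w by (auto simp: h_def simp flip: \<eta>\<^sub>Y_def)
    next
      case TL_Cap
      then show ?thesis
        using cap_word[OF w(1) _ lv] w lv
        by (auto simp: h_def val_mult mult.commute simp flip: \<epsilon>\<^sub>Y_def)
    qed
  qed (use Gen(2) in auto)
  then show ?case
    using lin_collect[of m "a + snd (TL_ar g) + b" "map h p"] by (simp add: h_def)
next
  case (Idt n)
  then show ?case by (simp flip: TL.ident_eq)
next
  case (Zer m n)
  then show ?case by (simp flip: TL.zero_eq)
next
  case (Cmp t u)
  then show ?case
    using Cmp(2)[of a b p] Cmp(1)[of a b "act a u p"]
    by (simp add: TL.layer_comp TL.comp_assoc flip: TL.comp_class)
next
  case (Tns t u)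
  then show ?case
    using Tns(2)[of "a + tdom TL_ar t" b p] Tns(1)[of a "tcod TL_ar u + b" "act (a + tdom TL_ar t) u p"]
    by (simp add: TL.layer_tensor TL.comp_assoc add.assoc flip: TL.tensor_class)
next
  case (Pls t u)
  then show ?case
    using Pls(1,2)[of a b p] lin_merge[of m "a + tcod TL_ar t + b" "act a t p" "act a u p"]
    by (simp add: TL.layer_plus TL.comp_plus flip: TL.plus_class)
next
  case (Scl c t)
  have "valid m (a + tcod TL_ar t + b) (map (\<lambda>(d, w). (gd_mult c d, w)) (act a t p)) \<and>
    lin m (a + tcod TL_ar t + b) (map (\<lambda>(d, w). (gd_mult c d, w)) (act a t p))
      = (val c \<odot>\<^bsub>\<T>\<^esub> \<one>\<^bsub>\<T>\<^esub> (a + tcod TL_ar t + b)) \<cdot>\<^bsub>\<T>\<^esub> lin m (a + tcod TL_ar t + b) (act a t p)"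
    using Scl by (intro lin_map) (auto simp: val_mult mult.commute)
  then show ?case
    using Scl(2,3) Scl(1)[of a b p] by (simp flip: TL.scale_class)
qed

text \<open>
  The reduction starts from the empty word, which is the identity, so that what is reduced is the
  difference of the two terms.
\<close>

theorem interp_eqI:
  assumes "wft TL_ar t" "wft TL_ar u" "tdom TL_ar t = tdom TL_ar u" "tcod TL_ar t = tcod TL_ar u"
    and "act 0 (t +\<^sub>t GDyad (- 1) 0 0 *\<^sub>t u) [(GDyad 1 0 0, [])] = []"
  shows "interp t = interp u"
proof (rule TL.plus_eq_zeroD)
  show "interp t \<oplus>\<^bsub>\<T>\<^esub> (- 1) \<odot>\<^bsub>\<T>\<^esub> interp u = zero_arr \<T> (src (interp u)) (tgt (interp u))"
    using act[of "t +\<^sub>t GDyad (- 1) 0 0 *\<^sub>t u" "tdom TL_ar t" 0 0 "[(GDyad 1 0 0, [])]"] assms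
    by (simp flip: TL.scale_class TL.plus_class)
qed (use assms in auto)

end

section \<open>Quotients of presented categories\<close>

text \<open>
  Operations of the quotient are defined by choosing representatives, so they have to be shown
  independent of the choice.
\<close>

locale presentation_ideal = presentation ar R C for ar :: "'g \<Rightarrow> nat \<times> nat"
    and R :: "(('g, 'k::field) trm \<times> ('g, 'k) trm) set" and C (structure) +
  fixes S I :: "(nat, ('g, 'k) trm set) arrow set"
    and Q :: "(nat, (nat, ('g, 'k) trm set) arrow set, 'k) lmcat"
  assumes generators: "S \<subseteq> arrs C" and I_def: "I = tensor_ideal C S" and Q_def: "Q = quotient_cat C I"
begin

abbreviation qcls where "qcls \<equiv> coset C I"

lemma ideal_arrs: "f \<in> I \<Longrightarrow> f \<in> arrs C"
  unfolding I_def by (induction rule: tensor_ideal.induct) (use generators in auto)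

lemmas ideal_zero = tensor_ideal.zero[where C = C and S = S, folded I_def]
  and ideal_plus = tensor_ideal.plus[where C = C and S = S, folded I_def]
  and ideal_scale = tensor_ideal.scale[where C = C and S = S, folded I_def]
  and ideal_comp = tensor_ideal.comp_left[where C = C and S = S, folded I_def]
    tensor_ideal.comp_right[where C = C and S = S, folded I_def]
  and ideal_tensor = tensor_ideal.tensor_left[where C = C and S = S, folded I_def]
    tensor_ideal.tensor_right[where C = C and S = S, folded I_def]

text \<open>
  Congruence modulo the ideal, in the form \<open>f = g + h\<close> with \<open>h\<close> in the ideal rather than
  \<open>f - g\<close> in the ideal.  This avoids subtraction in the proofs that the operations respect it;
  \<open>cong_iff\<close> shows that both forms agree.
\<close>

definition cong :: "(nat, ('g, 'k) trm set) arrow \<Rightarrow> (nat, ('g, 'k) trm set) arrow \<Rightarrow> bool" where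
  "cong f g \<longleftrightarrow> g \<in> arrs C \<and> (\<exists>h \<in> I. src h = src g \<and> tgt h = tgt g \<and> f = g \<oplus> h)"

lemma cong_arr:
  assumes "cong f g"
  shows "f \<in> arrs C" "g \<in> arrs C" "src f = src g" "tgt f = tgt g"
  using assms ideal_arrs by (auto simp: cong_def)

lemma cong_refl: "f \<in> arrs C \<Longrightarrow> cong f f"
  unfolding cong_def using ideal_zero[of "src f" "tgt f"]
  by (auto intro!: bexI[of _ "zero_arr C (src f) (tgt f)"])

lemma cong_sym:
  assumes "cong f g" shows "cong g f"
proof -
  obtain h where h: "h \<in> I" "src h = src g" "tgt h = tgt g" "f = g \<oplus> h" and g: "g \<in> arrs C"
    using assms by (auto simp: cong_def)
  then have "g = f \<oplus> (- 1) \<odot> h"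
    using ideal_arrs[of h] plus_neg[of h] by (simp add: plus_assoc)
  then show ?thesis
    using h g ideal_arrs[of h] ideal_scale[of h "- 1"] unfolding cong_def
    by (intro conjI bexI[of _ "(- 1) \<odot> h"]) auto
qed

lemma cong_trans:
  assumes "cong f g" "cong g h" shows "cong f h"
proof -
  obtain a b where "a \<in> I" "src a = src g" "tgt a = tgt g" "f = g \<oplus> a"
    "b \<in> I" "src b = src h" "tgt b = tgt h" "g = h \<oplus> b" "h \<in> arrs C"
    using assms by (auto simp: cong_def)
  then show ?thesis
    using ideal_arrs[of a] ideal_arrs[of b] ideal_plus[of b a] unfolding cong_def
    by (intro conjI bexI[of _ "b \<oplus> a"]) (auto simp: plus_assoc)
qed

lemma cong_iff:
  assumes "f \<in> arrs C" "g \<in> hom C (src f) (tgt f)"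
  shows "g \<oplus> (- 1) \<odot> f \<in> I \<longleftrightarrow> cong g f"
proof
  have g: "g = f \<oplus> (g \<oplus> (- 1) \<odot> f)"
    using assms plus_commute[of g "(- 1) \<odot> f"] plus_neg[of f]
    by (simp add: hom_def flip: plus_assoc)
  show "cong g f" if "g \<oplus> (- 1) \<odot> f \<in> I"
    using that g assms unfolding cong_def
    by (intro conjI bexI[of _ "g \<oplus> (- 1) \<odot> f"]) (auto simp: hom_def)
  show "g \<oplus> (- 1) \<odot> f \<in> I" if cong: "cong g f"
  proof -
    obtain h where h: "h \<in> I" "src h = src f" "tgt h = tgt f" "g = f \<oplus> h"
      using cong by (auto simp: cong_def)
    have "(f \<oplus> h) \<oplus> (- 1) \<odot> f = (h \<oplus> f) \<oplus> (- 1) \<odot> f"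
      using h assms ideal_arrs[of h] by (simp add: plus_commute)
    also have "\<dots> = h"
      using h assms ideal_arrs[of h] plus_neg[of f] by (simp add: plus_assoc)
    finally show ?thesis using h by simp
  qed
qed

lemma class_alt:
  assumes "f \<in> arrs C"
  shows "qcls f = Arrow (src f) (tgt f) {g. cong g f}"
  using assms cong_iff[OF assms] cong_arr[of _ f] by (auto simp: coset_def hom_def)

lemma class_eqI: "cong f g \<Longrightarrow> qcls f = qcls g"
  using cong_arr[of f g] by (auto simp: class_alt intro: cong_trans cong_sym)

lemma rep_class_cong: "f \<in> arrs C \<Longrightarrow> cong (rep (qcls f)) f"
  using someI[of "\<lambda>g. cong g f" f] cong_refl[of f] by (simp add: rep_def class_alt)

lemma src_class_arr [simp]: "src (qcls f) = src f" and tgt_class_arr [simp]: "tgt (qcls f) = tgt f"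
  by (simp_all add: coset_def)

lemma cong_plus:
  assumes "cong f f'" "cong g g'" "src f = src g" "tgt f = tgt g"
  shows "cong (f \<oplus> g) (f' \<oplus> g')"
proof -
  obtain a b where h: "a \<in> I" "src a = src f'" "tgt a = tgt f'" "f = f' \<oplus> a"
    "b \<in> I" "src b = src g'" "tgt b = tgt g'" "g = g' \<oplus> b" "f' \<in> arrs C" "g' \<in> arrs C"
    using assms by (auto simp: cong_def)
  have ab: "a \<in> arrs C" "b \<in> arrs C" using h ideal_arrs by auto
  have "a \<oplus> (g' \<oplus> b) = (g' \<oplus> a) \<oplus> b"
    using h ab assms plus_commute[of a g'] by (simp flip: plus_assoc)
  then have "(f' \<oplus> a) \<oplus> (g' \<oplus> b) = (f' \<oplus> g') \<oplus> (a \<oplus> b)"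
    using h ab assms by (simp add: plus_assoc)
  then show ?thesis
    using h ab assms ideal_plus[of a b] unfolding cong_def
    by (intro conjI bexI[of _ "a \<oplus> b"]) (auto simp: plus_assoc)
qed

lemma cong_scale:
  assumes "cong f f'" shows "cong (c \<odot> f) (c \<odot> f')"
proof -
  obtain a where h: "a \<in> I" "src a = src f'" "tgt a = tgt f'" "f = f' \<oplus> a" "f' \<in> arrs C"
    using assms by (auto simp: cong_def)
  then show ?thesis
    using ideal_arrs[of a] ideal_scale[of a c] unfolding cong_def
    by (intro conjI bexI[of _ "c \<odot> a"]) (auto simp: scale_plus)
qed

lemma cong_comp:
  assumes "cong f f'" "cong g g'" "src f = tgt g"
  shows "cong (f \<cdot> g) (f' \<cdot> g')"
proof -
  obtain a b where h: "a \<in> I" "src a = src f'" "tgt a = tgt f'" "f = f' \<oplus> a"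
    "b \<in> I" "src b = src g'" "tgt b = tgt g'" "g = g' \<oplus> b" "f' \<in> arrs C" "g' \<in> arrs C"
    using assms by (auto simp: cong_def)
  have ab: "a \<in> arrs C" "b \<in> arrs C" using h ideal_arrs by auto
  have "a \<cdot> g' \<oplus> f \<cdot> b \<in> I"
    using h ab assms cong_arr[OF assms(1)] by (intro ideal_plus ideal_comp) auto
  \<comment> \<open>keeping \<open>f\<close> in the last summand leaves one correction term for each factor\<close>
  moreover have "f \<cdot> g = f' \<cdot> g' \<oplus> (a \<cdot> g' \<oplus> f \<cdot> b)"
    using h ab assms by (simp add: comp_plus plus_assoc)
  ultimately show ?thesis
    using h ab assms cong_arr[OF assms(1)] unfolding cong_def
    by (intro conjI bexI[of _ "a \<cdot> g' \<oplus> f \<cdot> b"]) auto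
qed

lemma cong_tensor:
  assumes "cong f f'" "cong g g'"
  shows "cong (f \<otimes> g) (f' \<otimes> g')"
proof -
  obtain a b where h: "a \<in> I" "src a = src f'" "tgt a = tgt f'" "f = f' \<oplus> a"
    "b \<in> I" "src b = src g'" "tgt b = tgt g'" "g = g' \<oplus> b" "f' \<in> arrs C" "g' \<in> arrs C"
    using assms by (auto simp: cong_def)
  have ab: "a \<in> arrs C" "b \<in> arrs C" using h ideal_arrs by auto
  have "a \<otimes> g' \<oplus> f \<otimes> b \<in> I"
    using h ab assms cong_arr[OF assms(1)] by (intro ideal_plus ideal_tensor) auto
  moreover have "f \<otimes> g = f' \<otimes> g' \<oplus> (a \<otimes> g' \<oplus> f \<otimes> b)"
    using h ab assms by (simp add: tensor_plus plus_assoc)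
  ultimately show ?thesis
    using h ab assms cong_arr[OF assms(1)] unfolding cong_def
    by (intro conjI bexI[of _ "a \<otimes> g' \<oplus> f \<otimes> b"]) auto
qed

lemma quot_simps [simp]:
  "objs Q = UNIV" "unit_obj Q = 0" "tensor_obj Q a b = a + b"
  "ident Q a = qcls (\<one> a)" "zero_arr Q a b = qcls (zero_arr C a b)"
  by (simp_all add: Q_def quotient_cat_def)

lemma arrs_quot: "F \<in> arrs Q \<longleftrightarrow> (\<exists>t. wft ar t \<and> F = qcls (q t))"
  by (force simp: Q_def quotient_cat_def arrs_iff)

lemma rep_qcls:
  assumes "wft ar t"
  shows "cong (rep (qcls (q t))) (q t)" "src (rep (qcls (q t))) = tdom ar t" "tgt (rep (qcls (q t))) = tcod ar t"
  using rep_class_cong[of "q t"] cong_arr[OF rep_class_cong[of "q t"]] assms by auto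

lemma quot_comp:
  assumes "wft ar (t \<circ>\<^sub>t u)"
  shows "compose Q (qcls (q t)) (qcls (q u)) = qcls (q (t \<circ>\<^sub>t u))"
proof -
  have "cong (rep (qcls (q t)) \<cdot> rep (qcls (q u))) (q t \<cdot> q u)"
    by (rule cong_comp[OF rep_qcls(1) rep_qcls(1)]) (use assms in \<open>simp_all add: rep_qcls\<close>)
  from class_eqI[OF this] show ?thesis
    using assms by (simp add: Q_def quotient_cat_def comp_class)
qed

lemma quot_tensor:
  assumes "wft ar (t \<otimes>\<^sub>t u)"
  shows "tensor_arr Q (qcls (q t)) (qcls (q u)) = qcls (q (t \<otimes>\<^sub>t u))"
proof -
  have "cong (rep (qcls (q t)) \<otimes> rep (qcls (q u))) (q t \<otimes> q u)"
    by (rule cong_tensor[OF rep_qcls(1) rep_qcls(1)]) (use assms in \<open>simp_all add: rep_qcls\<close>)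
  from class_eqI[OF this] show ?thesis
    using assms by (simp add: Q_def quotient_cat_def tensor_class)
qed

lemma quot_plus:
  assumes "wft ar (t +\<^sub>t u)"
  shows "plus_arr Q (qcls (q t)) (qcls (q u)) = qcls (q (t +\<^sub>t u))"
proof -
  have "cong (rep (qcls (q t)) \<oplus> rep (qcls (q u))) (q t \<oplus> q u)"
    by (rule cong_plus[OF rep_qcls(1) rep_qcls(1)]) (use assms in \<open>simp_all add: rep_qcls\<close>)
  from class_eqI[OF this] show ?thesis
    using assms by (simp add: Q_def quotient_cat_def plus_class)
qed

lemma quot_scale:
  assumes "wft ar t"
  shows "scale_arr Q c (qcls (q t)) = qcls (q (c *\<^sub>t t))"
  using class_eqI[OF cong_scale[OF rep_qcls(1)[OF assms]]] assms
  by (simp add: Q_def quotient_cat_def scale_class)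

end

section \<open>Objects with one summand in the Karoubi envelope\<close>

context presentation begin

abbreviation Add where "Add \<equiv> additive_envelope C"

lemma body_add_incl: "body (add_incl f) (0, 0) = f"
  by (simp add: add_incl_def mat_arrow_def)

lemma add_incl_inject [simp]: "add_incl f = add_incl g \<longleftrightarrow> f = g"
  by (metis body_add_incl)

lemma src_add_incl [simp]: "src (add_incl f) = [src f]" and tgt_add_incl [simp]: "tgt (add_incl f) = [tgt f]"
  by (simp_all add: add_incl_def mat_arrow_def)

lemma entry_add_incl [simp]: "entry (add_incl f) 0 0 = f"
  by (simp add: entry_def body_add_incl)

lemma mat_arrow_single: "M 0 0 = f \<Longrightarrow> mat_arrow [src f] [tgt f] M = add_incl f"
  by (auto simp: add_incl_def mat_arrow_def)

text \<open>
  Morphisms between formal sums with a single summand are matrices with one entry, so \<open>add_incl\<close>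
  identifies them with the morphisms of the given category.
\<close>

lemma hom_Add_single: "F \<in> hom Add [a] [b] \<longleftrightarrow> (\<exists>f \<in> hom C a b. F = add_incl f)"
proof
  assume "F \<in> hom Add [a] [b]"
  then obtain M where M: "F = mat_arrow [a] [b] M" "M 0 0 \<in> hom C a b"
    by (auto simp: hom_def additive_envelope_def mat_arrow_def)
  then have "F = add_incl (M 0 0)"
    using mat_arrow_single[of M "M 0 0"] by (simp add: hom_def)
  then show "\<exists>f \<in> hom C a b. F = add_incl f"
    using M by blast
next
  assume "\<exists>f \<in> hom C a b. F = add_incl f"
  then obtain f where f: "f \<in> hom C a b" "F = add_incl f" by blast
  have "F = mat_arrow [a] [b] (\<lambda>i j. f) \<and>
      (\<forall>i < length [b]. \<forall>j < length [a]. f \<in> hom C ([a] ! j) ([b] ! i))"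
    using f by (simp add: add_incl_def hom_def)
  then have "\<exists>as bs M. F = mat_arrow as bs M \<and>
      (\<forall>i < length bs. \<forall>j < length as. M i j \<in> hom C (as ! j) (bs ! i))"
    by blast
  then have "F \<in> arrs Add"
    by (simp add: additive_envelope_def)
  then show "F \<in> hom Add [a] [b]"
    using f by (simp add: hom_def)
qed

lemma Add_ops:
  shows ident_Add: "ident Add [n] = add_incl (\<one> n)"
    and comp_Add: "\<lbrakk>f \<in> arrs C; g \<in> arrs C; src f = tgt g\<rbrakk>
      \<Longrightarrow> compose Add (add_incl f) (add_incl g) = add_incl (f \<cdot> g)"
    and plus_Add: "\<lbrakk>f \<in> arrs C; g \<in> arrs C; src f = src g; tgt f = tgt g\<rbrakk>
      \<Longrightarrow> plus_arr Add (add_incl f) (add_incl g) = add_incl (f \<oplus> g)"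
    and scale_Add: "f \<in> arrs C \<Longrightarrow> scale_arr Add c (add_incl f) = add_incl (c \<odot> f)"
    and tensor_Add: "\<lbrakk>f \<in> arrs C; g \<in> arrs C\<rbrakk>
      \<Longrightarrow> tensor_arr Add (add_incl f) (add_incl g) = add_incl (f \<otimes> g)"
  using mat_arrow_single[of _ "\<one> n"] mat_arrow_single[of _ "f \<cdot> g"] mat_arrow_single[of _ "f \<oplus> g"]
    mat_arrow_single[of _ "c \<odot> f"] mat_arrow_single[of _ "f \<otimes> g"]
  by (simp_all add: additive_envelope_def sum_arr_def)

end

context presentation begin

lemma objs_Kar: "([a], add_incl e) \<in> objs (Kar C) \<longleftrightarrow> e \<in> hom C a a \<and> e \<cdot> e = e"
proof -
  have "([a], add_incl e) \<in> objs (Kar C) \<longleftrightarrow>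
    add_incl e \<in> hom Add [a] [a] \<and> compose Add (add_incl e) (add_incl e) = add_incl e"
    by (simp add: Kar_def idempotent_completion_def Let_def) (simp add: additive_envelope_def)
  then show ?thesis
    by (auto simp: hom_Add_single comp_Add hom_def[of C])
qed

text \<open>
  The morphisms of the form \<open>e' \<cdot> g \<cdot> e\<close> are those that absorb both idempotents, a condition that is
  easier to verify for a given morphism.
\<close>

lemma hom_Kar:
  assumes "e \<in> hom C a a" "e \<cdot> e = e" "e' \<in> hom C b b" "e' \<cdot> e' = e'"
  shows "F \<in> hom (Kar C) ([a], add_incl e) ([b], add_incl e') \<longleftrightarrow>
    (\<exists>f \<in> hom C a b. e' \<cdot> f = f \<and> f \<cdot> e = f \<and>
      F = Arrow ([a], add_incl e) ([b], add_incl e') (add_incl f))"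
proof -
  have obj: "([a], add_incl e) \<in> objs (Kar C)" "([b], add_incl e') \<in> objs (Kar C)"
    using assms objs_Kar by auto
  have comp: "compose Add (add_incl e') (compose Add (add_incl g) (add_incl e)) = add_incl (e' \<cdot> (g \<cdot> e))"
    if "g \<in> hom C a b" for g
    using assms that by (simp add: comp_Add hom_def)
  have "F \<in> hom (Kar C) ([a], add_incl e) ([b], add_incl e') \<longleftrightarrow>
    (\<exists>G \<in> hom Add [a] [b]. F = Arrow ([a], add_incl e) ([b], add_incl e')
      (compose Add (add_incl e') (compose Add G (add_incl e))))"
    using obj unfolding hom_def[of "Kar C"]
    by (auto simp: Kar_def idempotent_completion_def Let_def)
  also have "\<dots> \<longleftrightarrow> (\<exists>g \<in> hom C a b. F = Arrow ([a], add_incl e) ([b], add_incl e')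
      (compose Add (add_incl e') (compose Add (add_incl g) (add_incl e))))"
    by (auto simp: hom_Add_single)
  also have "\<dots> \<longleftrightarrow> (\<exists>g \<in> hom C a b.
      F = Arrow ([a], add_incl e) ([b], add_incl e') (add_incl (e' \<cdot> (g \<cdot> e))))"
    using comp by simp
  also have "\<dots> \<longleftrightarrow> (\<exists>f \<in> hom C a b. e' \<cdot> f = f \<and> f \<cdot> e = f \<and>
      F = Arrow ([a], add_incl e) ([b], add_incl e') (add_incl f))"
  proof
    assume "\<exists>g \<in> hom C a b. F = Arrow ([a], add_incl e) ([b], add_incl e') (add_incl (e' \<cdot> (g \<cdot> e)))"
    then obtain g where g: "g \<in> hom C a b"
      "F = Arrow ([a], add_incl e) ([b], add_incl e') (add_incl (e' \<cdot> (g \<cdot> e)))" by blast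
    have "e' \<cdot> (e' \<cdot> (g \<cdot> e)) = e' \<cdot> (g \<cdot> e)"
      using assms g comp_assoc[of e' e' "g \<cdot> e"] by (simp add: hom_def)
    moreover have "(e' \<cdot> (g \<cdot> e)) \<cdot> e = e' \<cdot> (g \<cdot> e)"
      using assms g by (simp add: hom_def comp_assoc)
    ultimately show "\<exists>f \<in> hom C a b. e' \<cdot> f = f \<and> f \<cdot> e = f \<and>
      F = Arrow ([a], add_incl e) ([b], add_incl e') (add_incl f)"
      using g assms by (intro bexI[of _ "e' \<cdot> (g \<cdot> e)"]) (simp_all add: hom_def)
  qed metis
  finally show ?thesis .
qed

text \<open>
  Uniqueness of duals, for an object that exists only as the image of the idempotent \<open>e\<close>: if \<open>u\<close>
  satisfies one of the two zigzag identities with the pairing \<open>p\<close> and \<open>v\<close> the other, contracting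
  the middle of \<open>u \<otimes> v\<close> with \<open>p\<close> gives \<open>v\<close> on the one hand and \<open>u\<close> on the other.
\<close>

lemma cup_unique:
  assumes "e \<in> hom C a a" "p \<in> hom C (a + a) 0" "u \<in> hom C 0 (a + a)" "v \<in> hom C 0 (a + a)"
    and idem: "e \<cdot> e = e" and eu: "(e \<otimes> e) \<cdot> u = u" and ev: "(e \<otimes> e) \<cdot> v = v"
    and pu: "(e \<otimes> p) \<cdot> (u \<otimes> e) = e" and pv: "(p \<otimes> e) \<cdot> (e \<otimes> v) = e"
  shows "u = v"
proof -
  note h = assms(1-4)[unfolded hom_def mem_Collect_eq]
  \<comment> \<open>the two orders in which the morphisms \<open>u\<close> and \<open>v\<close> can be applied\<close>
  have "u \<otimes> v = (e \<otimes> e \<otimes> v) \<cdot> u"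
    using h eu interchange[of "e \<otimes> e" v u "\<one> 0"] by (simp add: tensor_assoc)
  moreover have "u \<otimes> v = (u \<otimes> e \<otimes> e) \<cdot> v"
    using h ev interchange[of u "e \<otimes> e" "\<one> 0" v] by simp
  ultimately have "(e \<otimes> p \<otimes> e) \<cdot> (e \<otimes> e \<otimes> v) \<cdot> u = (e \<otimes> p \<otimes> e) \<cdot> (u \<otimes> e \<otimes> e) \<cdot> v"
    by simp
  then have "((e \<otimes> p \<otimes> e) \<cdot> (e \<otimes> e \<otimes> v)) \<cdot> u = ((e \<otimes> p \<otimes> e) \<cdot> (u \<otimes> e \<otimes> e)) \<cdot> v"
    using h by (simp add: comp_assoc)
  moreover have "(e \<otimes> p \<otimes> e) \<cdot> (e \<otimes> e \<otimes> v) = e \<otimes> e"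
    using h idem pv by (simp add: interchange)
  moreover have "(e \<otimes> p \<otimes> e) \<cdot> (u \<otimes> e \<otimes> e) = e \<otimes> e"
    using h idem pu interchange[of "e \<otimes> p" e "u \<otimes> e" e] by (simp add: tensor_assoc)
  ultimately show "u = v"
    using eu ev by simp
qed

end

section \<open>The images of the generators and their relations\<close>

text \<open>
  The images of the generators, written as terms with coefficients in \<open>gdyad\<close> so that they can be
  reduced.  The scalar \<open>GDyad 1 0 1\<close> is one half, and \<open>GDyad 0 1 0\<close> is the square root of \<open>- 1\<close>.
  The image of \<open>Cup\<close> is the copairing dual to the image of \<open>Cap\<close>: two nested cups, projected by the
  idempotent.
\<close>

definition crossing_term :: "(TL_gen, gdyad) trm" where
  "crossing_term = Idt (1 + 1) +\<^sub>t Gen TL_Cup \<circ>\<^sub>t Gen TL_Cap"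

definition proj_term :: "(TL_gen, gdyad) trm" where
  "proj_term = GDyad 1 0 1 *\<^sub>t (Idt (1 + 1) +\<^sub>t crossing_term)"

primrec gen_term :: "T_gen \<Rightarrow> (TL_gen, gdyad) trm" where
  "gen_term Cap = Gen TL_Cap \<circ>\<^sub>t (I\<^sub>t \<otimes>\<^sub>t Gen TL_Cap \<otimes>\<^sub>t I\<^sub>t) \<circ>\<^sub>t (proj_term \<otimes>\<^sub>t proj_term)"
| "gen_term Cup = (proj_term \<otimes>\<^sub>t proj_term) \<circ>\<^sub>t (I\<^sub>t \<otimes>\<^sub>t Gen TL_Cup \<otimes>\<^sub>t I\<^sub>t) \<circ>\<^sub>t Gen TL_Cup"
| "gen_term Mul = GDyad 0 1 0 *\<^sub>t
    (proj_term \<circ>\<^sub>t (I\<^sub>t \<otimes>\<^sub>t Gen TL_Cap \<otimes>\<^sub>t I\<^sub>t) \<circ>\<^sub>t (proj_term \<otimes>\<^sub>t proj_term))"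
| "gen_term Swap = (I\<^sub>t \<otimes>\<^sub>t crossing_term \<otimes>\<^sub>t I\<^sub>t) \<circ>\<^sub>t (crossing_term \<otimes>\<^sub>t crossing_term)
    \<circ>\<^sub>t (I\<^sub>t \<otimes>\<^sub>t crossing_term \<otimes>\<^sub>t I\<^sub>t) \<circ>\<^sub>t (proj_term \<otimes>\<^sub>t proj_term)"

text \<open>
  The image of the identity of the \<open>n\<close>-th power of \<open>X\<close>: this idempotent is the identity of the
  corresponding object of the Karoubi envelope.
\<close>

primrec pow_term :: "nat \<Rightarrow> (TL_gen, gdyad) trm" where
  "pow_term 0 = Idt 0"
| "pow_term (Suc n) = proj_term \<otimes>\<^sub>t pow_term n"

primrec img_term :: "(T_gen, gdyad) trm \<Rightarrow> (TL_gen, gdyad) trm" where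
  "img_term (Gen g) = gen_term g"
| "img_term (Idt n) = pow_term n"
| "img_term (Zer m n) = Zer (2 * m) (2 * n)"
| "img_term (t \<circ>\<^sub>t u) = img_term t \<circ>\<^sub>t img_term u"
| "img_term (t \<otimes>\<^sub>t u) = img_term t \<otimes>\<^sub>t img_term u"
| "img_term (t +\<^sub>t u) = img_term t +\<^sub>t img_term u"
| "img_term (c *\<^sub>t t) = c *\<^sub>t img_term t"

lemma proj_term_type [simp]:
  "wft TL_ar proj_term" "tdom TL_ar proj_term = 2" "tcod TL_ar proj_term = 2"
  by (simp_all add: proj_term_def crossing_term_def)

lemma crossing_term_type [simp]:
  "wft TL_ar crossing_term" "tdom TL_ar crossing_term = 2" "tcod TL_ar crossing_term = 2"
  by (simp_all add: crossing_term_def)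

lemma gen_term_type [simp]:
  "wft TL_ar (gen_term g)" "tdom TL_ar (gen_term g) = 2 * fst (T_ar g)"
  "tcod TL_ar (gen_term g) = 2 * snd (T_ar g)"
  by (cases g; simp)+

lemma pow_term_type [simp]:
  "wft TL_ar (pow_term n)" "tdom TL_ar (pow_term n) = 2 * n" "tcod TL_ar (pow_term n) = 2 * n"
  by (induction n) auto

lemma img_term_type:
  "wft T_ar t \<Longrightarrow> wft TL_ar (img_term t) \<and>
    tdom TL_ar (img_term t) = 2 * tdom T_ar t \<and> tcod TL_ar (img_term t) = 2 * tcod T_ar t"
  by (induction t) auto

definition reduces_equal :: "(TL_gen, gdyad) trm \<Rightarrow> (TL_gen, gdyad) trm \<Rightarrow> bool" where
  "reduces_equal t u \<longleftrightarrow> act 0 (t +\<^sub>t GDyad (- 1) 0 0 *\<^sub>t u) [(GDyad 1 0 0, [])] = []"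

text \<open>
  The relations of \<open>T_rels 3 1\<close>, and after them those that generate \<open>SL_ideal\<close>, with their scalars
  written in \<open>gdyad\<close>.
\<close>

definition T_relation_terms :: "((T_gen, gdyad) trm \<times> (T_gen, gdyad) trm) list" where
  "T_relation_terms =
   [ ((\<epsilon>\<^sub>t \<otimes>\<^sub>t I\<^sub>t) \<circ>\<^sub>t (I\<^sub>t \<otimes>\<^sub>t \<eta>\<^sub>t), I\<^sub>t),
     (I\<^sub>t, (I\<^sub>t \<otimes>\<^sub>t \<epsilon>\<^sub>t) \<circ>\<^sub>t (\<eta>\<^sub>t \<otimes>\<^sub>t I\<^sub>t)),
     (\<sigma>\<^sub>t, (m\<^sub>t \<otimes>\<^sub>t I\<^sub>t) \<circ>\<^sub>t (I\<^sub>t \<otimes>\<^sub>t \<eta>\<^sub>t)),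
     ((I\<^sub>t \<otimes>\<^sub>t \<epsilon>\<^sub>t) \<circ>\<^sub>t (s\<^sub>t \<otimes>\<^sub>t I\<^sub>t), (\<epsilon>\<^sub>t \<otimes>\<^sub>t I\<^sub>t) \<circ>\<^sub>t (I\<^sub>t \<otimes>\<^sub>t s\<^sub>t)),
     (s\<^sub>t \<circ>\<^sub>t s\<^sub>t, I\<^sub>t \<otimes>\<^sub>t I\<^sub>t),
     ((s\<^sub>t \<otimes>\<^sub>t I\<^sub>t) \<circ>\<^sub>t (I\<^sub>t \<otimes>\<^sub>t s\<^sub>t) \<circ>\<^sub>t (s\<^sub>t \<otimes>\<^sub>t I\<^sub>t),
      (I\<^sub>t \<otimes>\<^sub>t s\<^sub>t) \<circ>\<^sub>t (s\<^sub>t \<otimes>\<^sub>t I\<^sub>t) \<circ>\<^sub>t (I\<^sub>t \<otimes>\<^sub>t s\<^sub>t)),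
     ((I\<^sub>t \<otimes>\<^sub>t m\<^sub>t) \<circ>\<^sub>t (s\<^sub>t \<otimes>\<^sub>t I\<^sub>t) \<circ>\<^sub>t (I\<^sub>t \<otimes>\<^sub>t s\<^sub>t), s\<^sub>t \<circ>\<^sub>t (m\<^sub>t \<otimes>\<^sub>t I\<^sub>t)),
     ((I\<^sub>t \<otimes>\<^sub>t s\<^sub>t) \<circ>\<^sub>t (s\<^sub>t \<otimes>\<^sub>t I\<^sub>t) \<circ>\<^sub>t (I\<^sub>t \<otimes>\<^sub>t \<sigma>\<^sub>t), (\<sigma>\<^sub>t \<otimes>\<^sub>t I\<^sub>t) \<circ>\<^sub>t s\<^sub>t),
     (\<epsilon>\<^sub>t \<circ>\<^sub>t s\<^sub>t, \<epsilon>\<^sub>t),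
     (m\<^sub>t \<circ>\<^sub>t s\<^sub>t, GDyad (- 1) 0 0 *\<^sub>t m\<^sub>t),
     (m\<^sub>t \<circ>\<^sub>t \<sigma>\<^sub>t, GDyad 1 0 0 *\<^sub>t I\<^sub>t),
     (\<epsilon>\<^sub>t \<circ>\<^sub>t \<eta>\<^sub>t, GDyad 3 0 0 *\<^sub>t Idt 0) ]"

definition SL_relation_terms :: "((T_gen, gdyad) trm \<times> (T_gen, gdyad) trm) list" where
  "SL_relation_terms =
   [ (D\<^sub>t, K\<^sub>t +\<^sub>t GDyad (- 1) 0 0 *\<^sub>t H\<^sub>t),
     (K\<^sub>t, GDyad 1 0 1 *\<^sub>t (I\<^sub>t \<otimes>\<^sub>t I\<^sub>t +\<^sub>t GDyad (- 1) 0 0 *\<^sub>t s\<^sub>t)) ]"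

definition absorption_terms :: "((TL_gen, gdyad) trm \<times> (TL_gen, gdyad) trm) list" where
  "absorption_terms = (proj_term \<circ>\<^sub>t proj_term, proj_term)
    # map (\<lambda>g. (pow_term (snd (T_ar g)) \<circ>\<^sub>t gen_term g, gen_term g)) [Mul, Swap, Cup, Cap]
    @ map (\<lambda>g. (gen_term g \<circ>\<^sub>t pow_term (fst (T_ar g)), gen_term g)) [Mul, Swap, Cup, Cap]"

text \<open>
  The costliest of these calculations is the braid relation for the image of \<open>Swap\<close>, which takes
  place in the endomorphisms of the sixth power of \<open>Y\<close>.
\<close>

lemma absorption_checked: "list_all (\<lambda>(t, u). reduces_equal t u) absorption_terms"
  by code_simp

lemma SL_relations_checked:
  "list_all (\<lambda>(t, u). reduces_equal (img_term t) (img_term u)) SL_relation_terms"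
  by code_simp

lemma T_relations_checked:
  "list_all (\<lambda>(t, u). reduces_equal (img_term t) (img_term u)) T_relation_terms"
  by code_simp

section \<open>The functor and its uniqueness\<close>

global_interpretation T: presentation T_ar "T_rels 3 1" "T_cat 3 1"
  by unfold_locales (simp add: T_cat_def)

abbreviation SL_generators :: "(nat, (T_gen, 'k::field) trm set) arrow set" where
  "SL_generators \<equiv>
    { tclass T_ar (T_rels 3 1) (D\<^sub>t +\<^sub>t (- 1) *\<^sub>t (K\<^sub>t +\<^sub>t (- 1) *\<^sub>t H\<^sub>t)),
      tclass T_ar (T_rels 3 1)
        (K\<^sub>t +\<^sub>t (- 1) *\<^sub>t (1 / 2) *\<^sub>t (I\<^sub>t \<otimes>\<^sub>t I\<^sub>t +\<^sub>t (- 1) *\<^sub>t s\<^sub>t)) }"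

lemma wft_SL [simp]:
  "wft T_ar \<sigma>\<^sub>t" "tdom T_ar \<sigma>\<^sub>t = 1" "tcod T_ar \<sigma>\<^sub>t = 2"
  "wft T_ar K\<^sub>t" "tdom T_ar K\<^sub>t = 2" "tcod T_ar K\<^sub>t = 2"
  "wft T_ar H\<^sub>t" "tdom T_ar H\<^sub>t = 2" "tcod T_ar H\<^sub>t = 2"
  "wft T_ar D\<^sub>t" "tdom T_ar D\<^sub>t = 2" "tcod T_ar D\<^sub>t = 2"
  by (simp_all add: \<sigma>\<^sub>t_def K\<^sub>t_def H\<^sub>t_def D\<^sub>t_def)

global_interpretation SL: presentation_ideal T_ar "T_rels 3 1" "T_cat 3 1" SL_generators SL_ideal SL
  by unfold_locales (simp_all add: SL_ideal_def SL_def)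

context root_of_minus_one begin

abbreviation qT :: "(T_gen, 'k) trm \<Rightarrow> (nat, (T_gen, 'k) trm set) arrow" where "qT \<equiv> T.q"
abbreviation qSL :: "(T_gen, 'k) trm \<Rightarrow> (nat, (nat, (T_gen, 'k) trm set) arrow set) arrow"
  where "qSL t \<equiv> SL.qcls (T.q t)"

abbreviation e :: "(nat, (TL_gen, 'k) trm set) arrow" where "e \<equiv> interp proj_term"
abbreviation pow :: "nat \<Rightarrow> (nat, (TL_gen, 'k) trm set) arrow" where "pow n \<equiv> interp (pow_term n)"

lemma equal_by_reduction:
  assumes "reduces_equal t u" "wft TL_ar t" "wft TL_ar u" "tdom TL_ar t = tdom TL_ar u" "tcod TL_ar t = tcod TL_ar u"
  shows "interp t = interp u"
  using assms interp_eqI by (simp add: reduces_equal_def)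

lemma pow_simps: "pow 0 = \<one>\<^bsub>\<T>\<^esub> 0" "pow (Suc n) = e \<otimes>\<^bsub>\<T>\<^esub> pow n"
  by (simp_all add: TL.ident_eq TL.tensor_class)

lemma pow_1 [simp]: "pow (Suc 0) = e"
  unfolding pow_simps by simp

lemma pow_add: "pow (m + n) = pow m \<otimes>\<^bsub>\<T>\<^esub> pow n"
  by (induction m) (simp_all add: pow_simps TL.tensor_assoc del: pow_term.simps)

lemma e_idem: "e \<cdot>\<^bsub>\<T>\<^esub> e = e"
  using absorption_checked equal_by_reduction[of "proj_term \<circ>\<^sub>t proj_term" proj_term]
  by (simp add: absorption_terms_def TL.comp_class)

lemma pow_idem: "pow n \<cdot>\<^bsub>\<T>\<^esub> pow n = pow n"
  by (induction n) (simp_all add: pow_simps TL.interchange e_idem del: pow_term.simps)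

text \<open>
  The target of \<open>img\<close> is \<open>\<T>\<close> itself, where it preserves compositions but not identities; it becomes
  a functor only after passing to the Karoubi envelope.
\<close>

primrec img :: "(T_gen, 'k) trm \<Rightarrow> (nat, (TL_gen, 'k) trm set) arrow" where
  "img (Gen g) = interp (gen_term g)"
| "img (Idt n) = pow n"
| "img (Zer m n) = zero_arr \<T> (2 * m) (2 * n)"
| "img (t \<circ>\<^sub>t u) = img t \<cdot>\<^bsub>\<T>\<^esub> img u"
| "img (t \<otimes>\<^sub>t u) = img t \<otimes>\<^bsub>\<T>\<^esub> img u"
| "img (t +\<^sub>t u) = img t \<oplus>\<^bsub>\<T>\<^esub> img u"
| "img (c *\<^sub>t t) = c \<odot>\<^bsub>\<T>\<^esub> img t"

lemma img_hom: "wft T_ar t \<Longrightarrow> img t \<in> hom \<T> (2 * tdom T_ar t) (2 * tcod T_ar t)"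
  by (induction t) (auto simp: hom_def)

lemma img_arr [simp]:
  assumes "wft T_ar t"
  shows "img t \<in> arrs \<T>" "src (img t) = 2 * tdom T_ar t" "tgt (img t) = 2 * tcod T_ar t"
  using img_hom[OF assms] by (auto simp: hom_def)

lemma img_map:
  "wft T_ar t \<Longrightarrow> img (map_trm (\<lambda>x. x) val t) = interp (img_term t)"
  by (induction t)
    (auto simp: TL.zero_eq TL.comp_class TL.tensor_class TL.plus_class TL.scale_class img_term_type)

text \<open>
  For generators this is part of the calculations; the operations inherit it because tensor powers
  of the idempotent are multiplicative and idempotent.
\<close>

lemma img_absorb:
  "wft T_ar t \<Longrightarrow> pow (tcod T_ar t) \<cdot>\<^bsub>\<T>\<^esub> img t = img t \<and> img t \<cdot>\<^bsub>\<T>\<^esub> pow (tdom T_ar t) = img t"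
proof (induction t)
  case (Gen g)
  have "reduces_equal (pow_term (snd (T_ar g)) \<circ>\<^sub>t gen_term g) (gen_term g)"
    "reduces_equal (gen_term g \<circ>\<^sub>t pow_term (fst (T_ar g))) (gen_term g)"
    using absorption_checked by (cases g; simp add: absorption_terms_def)+
  then show ?case
    using equal_by_reduction[of "pow_term (snd (T_ar g)) \<circ>\<^sub>t gen_term g" "gen_term g"]
      equal_by_reduction[of "gen_term g \<circ>\<^sub>t pow_term (fst (T_ar g))" "gen_term g"]
    by (simp add: TL.comp_class)
next
  case (Cmp t u)
  then show ?case
    by (simp add: TL.comp_assoc) (simp flip: TL.comp_assoc)
qed (auto simp: pow_idem pow_add TL.interchange TL.comp_plus)

lemma T_rels_terms:
  "T_rels 3 1 = map_prod (map_trm (\<lambda>x. x) val) (map_trm (\<lambda>x. x) val) ` set T_relation_terms"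
  by (simp add: T_rels_def T_relation_terms_def \<sigma>\<^sub>t_def)

lemma img_rel:
  assumes "(t, u) \<in> set T_relation_terms \<or> (t, u) \<in> set SL_relation_terms"
    and "wft T_ar t" "wft T_ar u" "tdom T_ar t = tdom T_ar u" "tcod T_ar t = tcod T_ar u"
  shows "img (map_trm (\<lambda>x. x) val t) = img (map_trm (\<lambda>x. x) val u)"
proof -
  have "reduces_equal (img_term t) (img_term u)"
    using assms(1) T_relations_checked SL_relations_checked by (auto simp: list_all_iff)
  then show ?thesis
    using assms(2-) img_term_type[of t] img_term_type[of u]
    by (simp add: img_map equal_by_reduction)
qed

text \<open>
  Apart from the defining relations, the axioms that mention identities are at stake, because \<open>img\<close>
  sends identities to idempotents.  The unit laws of composition hold by \<open>img_absorb\<close>, and the laws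
  relating identities to the tensor product because tensor powers are multiplicative.
\<close>

lemma img_teq: "teq T_ar (T_rels 3 1) t u \<Longrightarrow> img t = img u"
proof (induction rule: teq.induct)
  case (rel t u)
  then obtain t' u' where tu: "(t', u') \<in> set T_relation_terms"
    "t = map_trm (\<lambda>x. x) val t'" "u = map_trm (\<lambda>x. x) val u'"
    by (auto simp: T_rels_terms)
  then show ?case
    using rel by (simp add: img_rel)
next
  case (cmp_id_left t)
  then show ?case by (simp add: img_absorb)
next
  case (cmp_id_right t)
  then show ?case by (simp add: img_absorb)
next
  case (tns_unit_left t)
  then show ?case using pow_simps(1) by simp
next
  case (tns_unit_right t)
  then show ?case using pow_simps(1) by simp
qed (auto simp: pow_add TL.comp_assoc TL.tensor_assoc TL.interchange TL.plus_assoc TL.plus_neg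
    TL.scale_plus TL.plus_scale TL.comp_plus TL.tensor_plus distrib_left intro: TL.plus_commute)

definition img_arrow :: "(nat, (T_gen, 'k) trm set) arrow \<Rightarrow> (nat, (TL_gen, 'k) trm set) arrow" where
  "img_arrow f = img (rep f)"

lemma img_arrow [simp]: "wft T_ar t \<Longrightarrow> img_arrow (qT t) = img t"
  using img_teq[OF T.rep_class] by (simp add: img_arrow_def)

lemma img_arrow_ideal:
  "f \<in> SL_ideal \<Longrightarrow> f \<in> arrs (T_cat 3 1) \<and> img_arrow f = zero_arr \<T> (2 * src f) (2 * tgt f)"
  unfolding SL_ideal_def
proof (induction rule: tensor_ideal.induct)
  case (gen f)
  have D: "img D\<^sub>t = img (K\<^sub>t +\<^sub>t (- 1) *\<^sub>t H\<^sub>t)"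
    using img_rel[of "D\<^sub>t" "K\<^sub>t +\<^sub>t GDyad (- 1) 0 0 *\<^sub>t H\<^sub>t"]
    by (simp add: SL_relation_terms_def D\<^sub>t_def K\<^sub>t_def H\<^sub>t_def \<sigma>\<^sub>t_def)
  have K: "img K\<^sub>t = img ((1 / 2) *\<^sub>t (I\<^sub>t \<otimes>\<^sub>t I\<^sub>t +\<^sub>t (- 1) *\<^sub>t s\<^sub>t))"
    using img_rel[of "K\<^sub>t" "GDyad 1 0 1 *\<^sub>t (I\<^sub>t \<otimes>\<^sub>t I\<^sub>t +\<^sub>t GDyad (- 1) 0 0 *\<^sub>t s\<^sub>t)"]
    by (simp add: SL_relation_terms_def K\<^sub>t_def \<sigma>\<^sub>t_def)
  have zero: "img (t +\<^sub>t (- 1) *\<^sub>t u) = zero_arr \<T> (2 * tdom T_ar t) (2 * tcod T_ar t)"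
    if "img t = img u" "wft T_ar t" "wft T_ar u" "tdom T_ar t = tdom T_ar u" "tcod T_ar t = tcod T_ar u"
    for t u
    using that TL.plus_neg[of "img t"] by simp
  from gen show ?case
    using zero[OF D] zero[OF K] by (auto simp del: img.simps)
next
  case (zero a b)
  then show ?case using img_arrow[of "Zer a b"] by (simp add: T.zero_eq)
qed (auto elim!: T.arrsE simp: T.comp_class T.tensor_class T.plus_class T.scale_class)

text \<open>
  Since the ideal is mapped to zero, \<open>img_arrow\<close> descends to the quotient.
\<close>

lemma img_arrow_cong:
  assumes "SL.cong f g"
  shows "img_arrow f = img_arrow g"
proof -
  obtain h where h: "h \<in> SL_ideal" "src h = src g" "tgt h = tgt g" "f = g \<oplus>\<^bsub>T_cat 3 1\<^esub> h" "g \<in> arrs (T_cat 3 1)"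
    using assms by (auto simp: SL.cong_def)
  obtain t u where "wft T_ar t" "g = qT t" "wft T_ar u" "h = qT u"
    using h img_arrow_ideal[of h] by (auto elim!: T.arrsE)
  then show ?thesis
    using h img_arrow_ideal[of h] by (simp add: T.plus_class)
qed

lemma img_arrow_rep: "wft T_ar t \<Longrightarrow> img_arrow (rep (qSL t)) = img t"
  using img_arrow_cong[OF SL.rep_qcls(1)] by simp

definition X_power :: "nat \<Rightarrow> nat list \<times> (nat list, nat \<times> nat \<Rightarrow> (nat, (TL_gen, 'k) trm set) arrow) arrow" where
  "X_power n = ([2 * n], add_incl (pow n))"

text \<open>
  Every morphism of the Karoubi envelope between powers of the image of \<open>X\<close> has this form
  (\<open>hom_Kar_X\<close>).
\<close>

definition kar :: "nat \<Rightarrow> nat \<Rightarrow> (nat, (TL_gen, 'k) trm set) arrow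
    \<Rightarrow> (nat list \<times> (nat list, nat \<times> nat \<Rightarrow> (nat, (TL_gen, 'k) trm set) arrow) arrow,
        (nat list, nat \<times> nat \<Rightarrow> (nat, (TL_gen, 'k) trm set) arrow) arrow) arrow" where
  "kar m n f = Arrow (X_power m) (X_power n) (add_incl f)"

lemma kar_inject [simp]: "kar m n f = kar m n g \<longleftrightarrow> f = g"
  by (simp add: kar_def)

lemma X_power_objs: "X_power n \<in> objs (Kar \<T>)"
  by (simp add: X_power_def TL.objs_Kar pow_idem hom_def)

lemma hom_Kar_X:
  "F \<in> hom (Kar \<T>) (X_power m) (X_power n) \<longleftrightarrow>
    (\<exists>f \<in> hom \<T> (2 * m) (2 * n). pow n \<cdot>\<^bsub>\<T>\<^esub> f = f \<and> f \<cdot>\<^bsub>\<T>\<^esub> pow m = f \<and> F = kar m n f)"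
  unfolding X_power_def kar_def by (rule TL.hom_Kar) (simp_all add: hom_def pow_idem)

lemma Kar_objs:
  shows unit_Kar: "unit_obj (Kar \<T>) = X_power 0"
    and tensor_obj_Kar: "X_power m \<boxtimes>\<^bsub>Kar \<T>\<^esub> X_power n = X_power (m + n)"
proof -
  have Add: "unit_obj TL.Add = [0]" "tensor_obj TL.Add [m] [n] = [m + n]" for m n
    by (simp_all add: additive_envelope_def)
  show "unit_obj (Kar \<T>) = X_power 0"
    using pow_simps(1)
    by (simp add: Kar_def idempotent_completion_def Let_def X_power_def Add TL.ident_Add)
  show "X_power m \<boxtimes>\<^bsub>Kar \<T>\<^esub> X_power n = X_power (m + n)"
    by (simp add: Kar_def idempotent_completion_def Let_def X_power_def Add TL.tensor_Add pow_add)
qed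

lemma Kar_ops:
  shows ident_Kar: "\<one>\<^bsub>Kar \<T>\<^esub> (X_power n) = kar n n (pow n)"
    and comp_Kar: "\<lbrakk>f \<in> hom \<T> (2 * n) (2 * p); g \<in> hom \<T> (2 * m) (2 * n)\<rbrakk>
      \<Longrightarrow> kar n p f \<cdot>\<^bsub>Kar \<T>\<^esub> kar m n g = kar m p (f \<cdot>\<^bsub>\<T>\<^esub> g)"
    and plus_Kar: "\<lbrakk>f \<in> hom \<T> (2 * m) (2 * n); g \<in> hom \<T> (2 * m) (2 * n)\<rbrakk>
      \<Longrightarrow> kar m n f \<oplus>\<^bsub>Kar \<T>\<^esub> kar m n g = kar m n (f \<oplus>\<^bsub>\<T>\<^esub> g)"
    and scale_Kar: "f \<in> hom \<T> (2 * m) (2 * n) \<Longrightarrow> c \<odot>\<^bsub>Kar \<T>\<^esub> kar m n f = kar m n (c \<odot>\<^bsub>\<T>\<^esub> f)"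
    and tensor_Kar: "\<lbrakk>f \<in> hom \<T> (2 * m) (2 * n); g \<in> hom \<T> (2 * m') (2 * n')\<rbrakk>
      \<Longrightarrow> kar m n f \<otimes>\<^bsub>Kar \<T>\<^esub> kar m' n' g = kar (m + m') (n + n') (f \<otimes>\<^bsub>\<T>\<^esub> g)"
proof -
  let ?A = "additive_envelope \<T> :: (nat list, nat \<times> nat \<Rightarrow> (nat, (TL_gen, 'k) trm set) arrow, 'k) lmcat"
  have t: "X_power (m + n) = (tensor_obj ?A (fst (X_power m)) (fst (X_power n)),
      tensor_arr ?A (snd (X_power m)) (snd (X_power n)))" for m n
    by (subst tensor_obj_Kar[symmetric])
      (simp add: Kar_def idempotent_completion_def Let_def case_prod_unfold)
  show "\<one>\<^bsub>Kar \<T>\<^esub> (X_power n) = kar n n (pow n)"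
    by (simp add: Kar_def idempotent_completion_def Let_def X_power_def kar_def)
  show "\<lbrakk>f \<in> hom \<T> (2 * n) (2 * p); g \<in> hom \<T> (2 * m) (2 * n)\<rbrakk>
      \<Longrightarrow> kar n p f \<cdot>\<^bsub>Kar \<T>\<^esub> kar m n g = kar m p (f \<cdot>\<^bsub>\<T>\<^esub> g)"
    by (simp add: Kar_def idempotent_completion_def Let_def kar_def hom_def TL.comp_Add)
  show "\<lbrakk>f \<in> hom \<T> (2 * m) (2 * n); g \<in> hom \<T> (2 * m) (2 * n)\<rbrakk>
      \<Longrightarrow> kar m n f \<oplus>\<^bsub>Kar \<T>\<^esub> kar m n g = kar m n (f \<oplus>\<^bsub>\<T>\<^esub> g)"
    by (simp add: Kar_def idempotent_completion_def Let_def kar_def hom_def TL.plus_Add)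
  show "f \<in> hom \<T> (2 * m) (2 * n) \<Longrightarrow> c \<odot>\<^bsub>Kar \<T>\<^esub> kar m n f = kar m n (c \<odot>\<^bsub>\<T>\<^esub> f)"
    by (simp add: Kar_def idempotent_completion_def Let_def kar_def hom_def TL.scale_Add)
  show "\<lbrakk>f \<in> hom \<T> (2 * m) (2 * n); g \<in> hom \<T> (2 * m') (2 * n')\<rbrakk>
      \<Longrightarrow> kar m n f \<otimes>\<^bsub>Kar \<T>\<^esub> kar m' n' g = kar (m + m') (n + n') (f \<otimes>\<^bsub>\<T>\<^esub> g)"
    by (simp add: Kar_def idempotent_completion_def Let_def kar_def hom_def TL.tensor_Add t)
qed

definition \<Phi> where
  "\<Phi> = Functor X_power
    (restrict (\<lambda>F. kar (src F) (tgt F) (img_arrow (rep F))) (arrs SL))"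

lemma obj_map_Phi [simp]: "obj_map \<Phi> n = X_power n"
  by (simp add: \<Phi>_def)

lemma arr_map_Phi: "wft T_ar t \<Longrightarrow> arr_map \<Phi> (qSL t) = kar (tdom T_ar t) (tcod T_ar t) (img t)"
  using SL.arrs_quot[of "qSL t"] by (auto simp: \<Phi>_def img_arrow_rep)

lemma Phi_functor: "linear_monoidal_functor SL (Kar \<T>) \<Phi>"
proof
  show "obj_map \<Phi> \<in> objs SL \<rightarrow>\<^sub>E objs (Kar \<T>)"
    by (simp add: X_power_objs PiE_def)
  show "arr_map \<Phi> \<in> extensional (arrs SL)"
    by (simp add: \<Phi>_def)
next
  fix f :: "(nat, (nat, (T_gen, 'k) trm set) arrow set) arrow"
  assume "f \<in> arrs SL"
  then obtain t where t: "wft T_ar t" "f = qSL t"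
    using SL.arrs_quot by blast
  then show "arr_map \<Phi> f \<in> hom (Kar \<T>) (obj_map \<Phi> (src f)) (obj_map \<Phi> (tgt f))"
    by (auto simp: arr_map_Phi hom_Kar_X img_absorb img_hom)
  show "arr_map \<Phi> (c \<odot>\<^bsub>SL\<^esub> f) = c \<odot>\<^bsub>Kar \<T>\<^esub> arr_map \<Phi> f" for c
    using t by (simp add: SL.quot_scale arr_map_Phi scale_Kar img_hom)
  fix g :: "(nat, (nat, (T_gen, 'k) trm set) arrow set) arrow"
  assume "g \<in> arrs SL"
  then obtain u where u: "wft T_ar u" "g = qSL u"
    using SL.arrs_quot by blast
  show "arr_map \<Phi> (g \<cdot>\<^bsub>SL\<^esub> f) = arr_map \<Phi> g \<cdot>\<^bsub>Kar \<T>\<^esub> arr_map \<Phi> f" if "src g = tgt f"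
    using t u that img_hom[of t] img_hom[of u] by (simp add: SL.quot_comp arr_map_Phi comp_Kar)
  show "arr_map \<Phi> (f \<oplus>\<^bsub>SL\<^esub> g) = arr_map \<Phi> f \<oplus>\<^bsub>Kar \<T>\<^esub> arr_map \<Phi> g" if "src f = src g" "tgt f = tgt g"
    using t u that img_hom[of t] img_hom[of u] by (simp add: SL.quot_plus arr_map_Phi plus_Kar)
  show "arr_map \<Phi> (f \<otimes>\<^bsub>SL\<^esub> g) = arr_map \<Phi> f \<otimes>\<^bsub>Kar \<T>\<^esub> arr_map \<Phi> g"
    using t u img_hom[of t] img_hom[of u] by (simp add: SL.quot_tensor arr_map_Phi tensor_Kar)
next
  show "arr_map \<Phi> (\<one>\<^bsub>SL\<^esub> a) = \<one>\<^bsub>Kar \<T>\<^esub> (obj_map \<Phi> a)" for a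
    using arr_map_Phi[of "Idt a"] by (simp add: ident_Kar T.ident_eq)
qed (simp_all add: unit_Kar tensor_obj_Kar)

text \<open>
  Both functors agree on all morphisms by induction on terms.  Two points need an argument: the
  cup, whose image is not assumed to agree, and zero morphisms, which a functor is only known to
  preserve because they are multiples by the scalar zero.
\<close>

lemma functor_unique:
  assumes "linear_monoidal_functor SL (Kar \<T>) \<Psi>"
    and X: "obj_map \<Psi> X_obj = X_power 1"
    and gens: "\<And>g. g \<noteq> Cup \<Longrightarrow> arr_map \<Psi> (qSL (Gen g)) = arr_map \<Phi> (qSL (Gen g))"
  shows "\<Psi> = \<Phi>"
proof -
  interpret \<Psi>: linear_monoidal_functor SL "Kar \<T>" \<Psi> by fact
  interpret \<Phi>: linear_monoidal_functor SL "Kar \<T>" \<Phi> by (rule Phi_functor)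
  have obj: "obj_map \<Psi> n = X_power n" for n
  proof (induction n)
    case 0
    then show ?case using \<Psi>.map_unit_obj by (simp add: unit_Kar)
  next
    case (Suc n)
    then show ?case using \<Psi>.map_tensor_obj[of 1 n] X by (simp add: tensor_obj_Kar X_obj_def)
  qed
  have arrs: "qSL t \<in> arrs SL" if "wft T_ar t" for t
    using that SL.arrs_quot by blast
  have form: "\<exists>f \<in> hom \<T> (2 * tdom T_ar t) (2 * tcod T_ar t). pow (tcod T_ar t) \<cdot>\<^bsub>\<T>\<^esub> f = f
      \<and> arr_map \<Psi> (qSL t) = kar (tdom T_ar t) (tcod T_ar t) f" if "wft T_ar t" for t
    using \<Psi>.arr_map[OF arrs[OF that]] by (auto simp: obj hom_Kar_X)
  have ident: "arr_map \<Psi> (qSL (Idt n)) = kar n n (pow n)" for n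
    using \<Psi>.map_ident[of n] by (simp add: obj ident_Kar T.ident_eq)
  have cup: "arr_map \<Psi> (qSL \<eta>\<^sub>t) = arr_map \<Phi> (qSL \<eta>\<^sub>t)"
  proof -
    obtain u where u: "u \<in> hom \<T> 0 4" "pow 2 \<cdot>\<^bsub>\<T>\<^esub> u = u" "arr_map \<Psi> (qSL \<eta>\<^sub>t) = kar 0 2 u"
      using form[of "\<eta>\<^sub>t"] by auto
    \<comment> \<open>\<open>u\<close> inherits a zigzag identity from functoriality of \<open>\<Psi>\<close>, and \<open>v\<close> the other one from \<open>img_teq\<close>\<close>
    define v p where "v = img \<eta>\<^sub>t" and "p = img \<epsilon>\<^sub>t"
    have v: "v \<in> hom \<T> 0 4" "pow 2 \<cdot>\<^bsub>\<T>\<^esub> v = v" "arr_map \<Phi> (qSL \<eta>\<^sub>t) = kar 0 2 v"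
      using img_hom[of "\<eta>\<^sub>t"] img_absorb[of "\<eta>\<^sub>t"] arr_map_Phi[of "\<eta>\<^sub>t"] by (simp_all add: v_def)
    have p: "p \<in> hom \<T> 4 0" "arr_map \<Psi> (qSL \<epsilon>\<^sub>t) = kar 2 0 p"
      using img_hom[of "\<epsilon>\<^sub>t"] gens[of Cap] arr_map_Phi[of "\<epsilon>\<^sub>t"] by (simp_all add: p_def)
    have e: "e \<in> hom \<T> 2 2" by (simp add: hom_def)
    have "teq T_ar (T_rels 3 1) ((\<epsilon>\<^sub>t \<otimes>\<^sub>t I\<^sub>t) \<circ>\<^sub>t (I\<^sub>t \<otimes>\<^sub>t \<eta>\<^sub>t)) (I\<^sub>t :: (T_gen, 'k) trm)"
      by (rule teq.rel) (simp_all add: T_rels_def)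
    from img_teq[OF this] have pv: "(p \<otimes>\<^bsub>\<T>\<^esub> e) \<cdot>\<^bsub>\<T>\<^esub> (e \<otimes>\<^bsub>\<T>\<^esub> v) = e"
      by (simp add: p_def v_def del: pow_term.simps)
    have "teq T_ar (T_rels 3 1) I\<^sub>t ((I\<^sub>t \<otimes>\<^sub>t \<epsilon>\<^sub>t) \<circ>\<^sub>t (\<eta>\<^sub>t \<otimes>\<^sub>t I\<^sub>t) :: (T_gen, 'k) trm)"
      by (rule teq.rel) (simp_all add: T_rels_def)
    note arg_cong[OF T.class_eqI[OF this], of SL.qcls]
    also have "qSL ((I\<^sub>t \<otimes>\<^sub>t \<epsilon>\<^sub>t) \<circ>\<^sub>t (\<eta>\<^sub>t \<otimes>\<^sub>t I\<^sub>t))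
      = (qSL I\<^sub>t \<otimes>\<^bsub>SL\<^esub> qSL \<epsilon>\<^sub>t) \<cdot>\<^bsub>SL\<^esub> (qSL \<eta>\<^sub>t \<otimes>\<^bsub>SL\<^esub> qSL I\<^sub>t)"
      by (simp add: SL.quot_comp SL.quot_tensor)
    finally have "qSL I\<^sub>t = (qSL I\<^sub>t \<otimes>\<^bsub>SL\<^esub> qSL \<epsilon>\<^sub>t) \<cdot>\<^bsub>SL\<^esub> (qSL \<eta>\<^sub>t \<otimes>\<^bsub>SL\<^esub> qSL I\<^sub>t)" .
    then have "arr_map \<Psi> (qSL I\<^sub>t)
      = arr_map \<Psi> ((qSL I\<^sub>t \<otimes>\<^bsub>SL\<^esub> qSL \<epsilon>\<^sub>t) \<cdot>\<^bsub>SL\<^esub> (qSL \<eta>\<^sub>t \<otimes>\<^bsub>SL\<^esub> qSL I\<^sub>t))"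
      by (rule arg_cong)
    also have "\<dots> = (arr_map \<Psi> (qSL I\<^sub>t) \<otimes>\<^bsub>Kar \<T>\<^esub> arr_map \<Psi> (qSL \<epsilon>\<^sub>t))
        \<cdot>\<^bsub>Kar \<T>\<^esub> (arr_map \<Psi> (qSL \<eta>\<^sub>t) \<otimes>\<^bsub>Kar \<T>\<^esub> arr_map \<Psi> (qSL I\<^sub>t))"
      using arrs[of "I\<^sub>t"] arrs[of "\<epsilon>\<^sub>t"] arrs[of "\<eta>\<^sub>t"] arrs[of "I\<^sub>t \<otimes>\<^sub>t \<epsilon>\<^sub>t"] arrs[of "\<eta>\<^sub>t \<otimes>\<^sub>t I\<^sub>t"]
      by (subst \<Psi>.map_compose) (simp_all add: SL.quot_tensor flip: \<Psi>.map_tensor_arr)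
    also have "\<dots> = (kar 1 1 e \<otimes>\<^bsub>Kar \<T>\<^esub> kar 2 0 p) \<cdot>\<^bsub>Kar \<T>\<^esub> (kar 0 2 u \<otimes>\<^bsub>Kar \<T>\<^esub> kar 1 1 e)"
      using ident[of 1] u p by (simp del: pow_term.simps)
    also have "kar 1 1 e \<otimes>\<^bsub>Kar \<T>\<^esub> kar 2 0 p = kar 3 1 (e \<otimes>\<^bsub>\<T>\<^esub> p)"
      using tensor_Kar[of e 1 1 p 2 0] e p by (simp add: numeral_3_eq_3)
    also have "kar 0 2 u \<otimes>\<^bsub>Kar \<T>\<^esub> kar 1 1 e = kar 1 3 (u \<otimes>\<^bsub>\<T>\<^esub> e)"
      using tensor_Kar[of u 0 2 e 1 1] e u by (simp add: numeral_3_eq_3)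
    also have "kar 3 1 (e \<otimes>\<^bsub>\<T>\<^esub> p) \<cdot>\<^bsub>Kar \<T>\<^esub> kar 1 3 (u \<otimes>\<^bsub>\<T>\<^esub> e)
      = kar 1 1 ((e \<otimes>\<^bsub>\<T>\<^esub> p) \<cdot>\<^bsub>\<T>\<^esub> (u \<otimes>\<^bsub>\<T>\<^esub> e))"
      using u p e by (intro comp_Kar) (simp_all add: hom_def)
    finally have "kar 1 1 e = kar 1 1 ((e \<otimes>\<^bsub>\<T>\<^esub> p) \<cdot>\<^bsub>\<T>\<^esub> (u \<otimes>\<^bsub>\<T>\<^esub> e))"
      using ident[of 1] by (simp del: pow_term.simps)
    then have pu: "(e \<otimes>\<^bsub>\<T>\<^esub> p) \<cdot>\<^bsub>\<T>\<^esub> (u \<otimes>\<^bsub>\<T>\<^esub> e) = e" by simp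
    have "pow 2 = e \<otimes>\<^bsub>\<T>\<^esub> e"
      using pow_add[of 1 1] by (simp del: pow_term.simps add: numeral_2_eq_2)
    then have "u = v"
      using TL.cup_unique[of e 2 p u v] u v p e e_idem pu pv by simp
    then show ?thesis using u v by simp
  qed
  have agree: "arr_map \<Psi> (qSL t) = arr_map \<Phi> (qSL t)" if "wft T_ar t" for t
    using that
  proof (induction t)
    case (Gen g)
    then show ?case using cup gens by (cases "g = Cup") auto
  next
    case (Idt n)
    then show ?case using ident arr_map_Phi[of "Idt n"] by simp
  next
    case (Zer m n)
    obtain f where "f \<in> hom \<T> (2 * m) (2 * n)" "arr_map \<Psi> (qSL (Zer m n)) = kar m n f"
      using form[of "Zer m n"] by auto
    then have "arr_map \<Psi> (qSL (0 *\<^sub>t Zer m n)) = kar m n (zero_arr \<T> (2 * m) (2 * n))"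
      using \<Psi>.map_scale[OF arrs, of "Zer m n" 0] by (simp add: SL.quot_scale scale_Kar) (simp add: hom_def)
    moreover have "qT (0 *\<^sub>t Zer m n) = qT (Zer m n)"
      by (simp flip: T.scale_class T.zero_eq)
    ultimately show ?case
      by (simp add: arr_map_Phi)
  next
    case (Cmp t u)
    then show ?case
      using \<Psi>.map_compose[OF arrs arrs, of u t] \<Phi>.map_compose[OF arrs arrs, of u t] by (simp add: SL.quot_comp)
  next
    case (Tns t u)
    then show ?case
      using \<Psi>.map_tensor_arr[OF arrs arrs, of t u] \<Phi>.map_tensor_arr[OF arrs arrs, of t u] by (simp add: SL.quot_tensor)
  next
    case (Pls t u)
    then show ?case
      using \<Psi>.map_plus[OF arrs arrs, of t u] \<Phi>.map_plus[OF arrs arrs, of t u] by (simp add: SL.quot_plus)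
  next
    case (Scl c t)
    then show ?case
      using \<Psi>.map_scale[OF arrs, of t c] \<Phi>.map_scale[OF arrs, of t c] by (simp add: SL.quot_scale)
  qed
  have "arr_map \<Psi> = arr_map \<Phi>"
  proof (rule extensionalityI[OF \<Psi>.arr_map_undefined \<Phi>.arr_map_undefined])
    fix F :: "(nat, (nat, (T_gen, 'k) trm set) arrow set) arrow"
    assume "F \<in> arrs SL"
    then obtain t where "wft T_ar t" "F = qSL t"
      using SL.arrs_quot by blast
    then show "arr_map \<Psi> F = arr_map \<Phi> F"
      using agree by simp
  qed
  moreover have "obj_map \<Psi> = obj_map \<Phi>"
    using obj by auto
  ultimately show ?thesis
    by (simp add: functor_data.expand)
qed

lemma crossing_eq: "s\<^sub>Y = interp crossing_term"
  by (simp add: s\<^sub>Y_def \<eta>\<^sub>Y_def \<epsilon>\<^sub>Y_def Y_obj_def TL.ops_class crossing_term_def)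

lemma proj_eq: "e\<^sub>Y = e"
  using arg_cong[OF crossing_eq, of "\<lambda>f. (1 / 2) \<odot>\<^bsub>\<T>\<^esub> (\<one>\<^bsub>\<T>\<^esub> (Suc (Suc 0)) \<oplus>\<^bsub>\<T>\<^esub> f)"]
  by (simp add: e\<^sub>Y_def Y_obj_def TL.ops_class proj_term_def)

lemma X_image_eq: "X_image = X_power 1"
  by (simp add: X_image_def X_power_def proj_eq Y_obj_def del: pow_term.simps)

lemma gen_images:
  shows "\<epsilon>\<^sub>Y \<cdot>\<^bsub>\<T>\<^esub> (\<one>\<^bsub>\<T>\<^esub> Y_obj \<otimes>\<^bsub>\<T>\<^esub> \<epsilon>\<^sub>Y \<otimes>\<^bsub>\<T>\<^esub> \<one>\<^bsub>\<T>\<^esub> Y_obj) \<cdot>\<^bsub>\<T>\<^esub> (e\<^sub>Y \<otimes>\<^bsub>\<T>\<^esub> e\<^sub>Y) = img \<epsilon>\<^sub>t"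
    and "\<i> \<odot>\<^bsub>\<T>\<^esub> (e\<^sub>Y \<cdot>\<^bsub>\<T>\<^esub> (\<one>\<^bsub>\<T>\<^esub> Y_obj \<otimes>\<^bsub>\<T>\<^esub> \<epsilon>\<^sub>Y \<otimes>\<^bsub>\<T>\<^esub> \<one>\<^bsub>\<T>\<^esub> Y_obj) \<cdot>\<^bsub>\<T>\<^esub> (e\<^sub>Y \<otimes>\<^bsub>\<T>\<^esub> e\<^sub>Y)) = img m\<^sub>t"
    and "(\<one>\<^bsub>\<T>\<^esub> Y_obj \<otimes>\<^bsub>\<T>\<^esub> s\<^sub>Y \<otimes>\<^bsub>\<T>\<^esub> \<one>\<^bsub>\<T>\<^esub> Y_obj) \<cdot>\<^bsub>\<T>\<^esub> (s\<^sub>Y \<otimes>\<^bsub>\<T>\<^esub> s\<^sub>Y)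
            \<cdot>\<^bsub>\<T>\<^esub> (\<one>\<^bsub>\<T>\<^esub> Y_obj \<otimes>\<^bsub>\<T>\<^esub> s\<^sub>Y \<otimes>\<^bsub>\<T>\<^esub> \<one>\<^bsub>\<T>\<^esub> Y_obj) \<cdot>\<^bsub>\<T>\<^esub> (e\<^sub>Y \<otimes>\<^bsub>\<T>\<^esub> e\<^sub>Y) = img s\<^sub>t"
  by (simp_all add: proj_eq crossing_eq \<epsilon>\<^sub>Y_def Y_obj_def TL.ops_class)

lemma Phi_gen: "arr_map \<Phi> (SL_gen g) = kar (fst (T_ar g)) (snd (T_ar g)) (img (Gen g))"
  using arr_map_Phi[of "Gen g"] by (simp add: SL_gen_def)

end

theorem proposition3p11:
  fixes i :: "'k::field"
  assumes "CHAR('k) \<noteq> 2"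
    and "(3::'k) \<noteq> - 2"
    and "i\<^sup>2 = - 1"
  shows "\<exists>!\<Phi>. linear_monoidal_functor (SL :: (nat, _, 'k) lmcat) (Kar \<T>) \<Phi>
    \<and> obj_map \<Phi> X_obj = X_image
    \<and> arr_map \<Phi> (SL_gen Cap) =
        Arrow (X_image \<boxtimes>\<^bsub>Kar \<T>\<^esub> X_image) (unit_obj (Kar \<T>))
          (add_incl (\<epsilon>\<^sub>Y \<cdot>\<^bsub>\<T>\<^esub> (\<one>\<^bsub>\<T>\<^esub> Y_obj \<otimes>\<^bsub>\<T>\<^esub> \<epsilon>\<^sub>Y \<otimes>\<^bsub>\<T>\<^esub> \<one>\<^bsub>\<T>\<^esub> Y_obj) \<cdot>\<^bsub>\<T>\<^esub> (e\<^sub>Y \<otimes>\<^bsub>\<T>\<^esub> e\<^sub>Y)))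
    \<and> arr_map \<Phi> (SL_gen Mul) =
        Arrow (X_image \<boxtimes>\<^bsub>Kar \<T>\<^esub> X_image) X_image
          (add_incl (i \<odot>\<^bsub>\<T>\<^esub> (e\<^sub>Y \<cdot>\<^bsub>\<T>\<^esub> (\<one>\<^bsub>\<T>\<^esub> Y_obj \<otimes>\<^bsub>\<T>\<^esub> \<epsilon>\<^sub>Y \<otimes>\<^bsub>\<T>\<^esub> \<one>\<^bsub>\<T>\<^esub> Y_obj) \<cdot>\<^bsub>\<T>\<^esub> (e\<^sub>Y \<otimes>\<^bsub>\<T>\<^esub> e\<^sub>Y))))
    \<and> arr_map \<Phi> (SL_gen Swap) =
        Arrow (X_image \<boxtimes>\<^bsub>Kar \<T>\<^esub> X_image) (X_image \<boxtimes>\<^bsub>Kar \<T>\<^esub> X_image)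
          (add_incl ((\<one>\<^bsub>\<T>\<^esub> Y_obj \<otimes>\<^bsub>\<T>\<^esub> s\<^sub>Y \<otimes>\<^bsub>\<T>\<^esub> \<one>\<^bsub>\<T>\<^esub> Y_obj) \<cdot>\<^bsub>\<T>\<^esub> (s\<^sub>Y \<otimes>\<^bsub>\<T>\<^esub> s\<^sub>Y)
            \<cdot>\<^bsub>\<T>\<^esub> (\<one>\<^bsub>\<T>\<^esub> Y_obj \<otimes>\<^bsub>\<T>\<^esub> s\<^sub>Y \<otimes>\<^bsub>\<T>\<^esub> \<one>\<^bsub>\<T>\<^esub> Y_obj) \<cdot>\<^bsub>\<T>\<^esub> (e\<^sub>Y \<otimes>\<^bsub>\<T>\<^esub> e\<^sub>Y)))"
proof -
  have "(2::'k) \<noteq> 0"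
  proof
    assume "(2::'k) = 0"
    then have "CHAR('k) dvd 2"
      using of_nat_eq_0_iff_char_dvd[of 2, where ?'a = 'k] by simp
    then have "CHAR('k) \<le> 2" "CHAR('k) \<noteq> 0"
      by (simp add: dvd_imp_le) (use \<open>CHAR('k) dvd 2\<close> in \<open>metis dvd_0_left_iff zero_neq_numeral\<close>)
    then show False
      using assms(1) CHAR_not_1[where ?'a = 'k] by linarith
  qed
  then interpret root_of_minus_one i
    using assms(3) by unfold_locales (simp_all add: power2_eq_square)
  have two: "X_power 1 \<boxtimes>\<^bsub>Kar \<T>\<^esub> X_power 1 = X_power 2"
    by (simp add: tensor_obj_Kar numeral_2_eq_2)
  show ?thesis
    unfolding gen_images X_image_eq two unit_Kar
  proof (rule ex1I[of _ \<Phi>], goal_cases)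
    case 1
    show ?case
      by (simp add: Phi_functor X_obj_def Phi_gen kar_def)
  next
    case (2 \<Psi>)
    then show ?case
    proof (intro functor_unique)
      fix g :: T_gen assume "g \<noteq> Cup"
      then show "arr_map \<Psi> (qSL (Gen g)) = arr_map \<Phi> (qSL (Gen g))"
        using 2 Phi_gen[of g] by (cases g) (simp_all add: SL_gen_def kar_def)
    qed auto
  qed
qed

end
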